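(* Let $0<c<1$. For every $n\ge1$ and $s,t\in\mathbb R$, $$(s^2+c^2t^2)^{1/2}\le N_{n,c}(s,t)\le(s^2+t^2)^{1/2}.$$ Consequently, for every $x=(x_j)_{j\ge0}\in c_{00}$, $$\left(|x_0|^2+c^2\sum_{j\ge1}|x_j|^2\right)^{1/2}\le\|x\|_{X_c}\le\|x\|_2.$$ In particular, $c\|x\|_2\le\|x\|_{X_c}\le\|x\|_2$ for every $x\in c_{00}$, so $X_c$ is isomorphic to $\ell_2$, is reflexive, and $$d_{\mathrm{BM}}(X_c,\ell_2)\le\frac1c.$$ The same bound holds for $X_c^*$, i.e. $d_{\mathrm{BM}}(X_c^*,\ell_2)\le\frac1c$.
   Context: All Banach spaces are real; $E^*$ is the dual of $E$ with the dual norm. The Banach--Mazur distance is $d_{\mathrm{BM}}(E,F)=\inf\{\|U\|\,\|U^{-1}\|: U:E\to F\text{ is an isomorphism}\}$. $\|x\|_2$ is the $\ell_2$ norm. Definition of $X_c$. A norm $N$ on $\mathbb R^2$ is absolute if $N(s,t)=N(|s|,|t|)$ and normalized if $N(1,0)=N(0,1)=1$. Given a sequence $(N_n)_{n\ge1}$ of absolute normalized norms on $\mathbb R^2$, define norms $M_n$ on $\mathbb R^{n+1}$ by $M_0(x_0)=|x_0|$ and $M_n(x_0,\dots,x_n)=N_n(M_{n-1}(x_0,\dots,x_{n-1}),|x_n|)$ for $n\ge1$. For a finitely supported real sequence $x=(x_j)_{j\ge0}\in c_{00}$ put $\|x\|=M_n(x_0,\dots,x_n)$ for any $n$ with $x_j=0$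 for all $j>n$ (this is independent of $n$). $A(N_n)$ denotes the completion of $c_{00}$ in this norm, with canonical basis $(e_j)_{j\ge0}$. For $0<c<1$ and $n\ge1$ let $$N_{n,c}(s,t)=\left[(1-c^{2n})|t|^{2n}+(s^2+c^2t^2)^n\right]^{1/(2n)},$$ which is an absolute normalized norm on $\mathbb R^2$, and set $X_c:=A(N_{n,c})$. *)

theory Defs
  imports "HOL-Analysis.Analysis"
begin

section \<open>Normed spaces on explicit carriers\<close>

text \<open>
  The space \<open>X\<^sub>c\<close> depends on the real number \<open>c\<close>, so it cannot be a type of class
  \<open>banach\<close>. Normed spaces are therefore records. The values of the operations
  outside the carrier carry no meaning.
\<close>

record 'a nspace =
  vcarrier :: "'a set"
  vzero :: 'a
  vadd :: "'a \<Rightarrow> 'a \<Rightarrow> 'a"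
  vscale :: "real \<Rightarrow> 'a \<Rightarrow> 'a"
  vnorm :: "'a \<Rightarrow> real"

definition vdist :: "'a nspace \<Rightarrow> 'a \<Rightarrow> 'a \<Rightarrow> real" where
  "vdist E x y = vnorm E (vadd E x (vscale E (-1) y))"

definition cauchy_seqs :: "'a nspace \<Rightarrow> (nat \<Rightarrow> 'a) set" where
  "cauchy_seqs E = {X. (\<forall>i. X i \<in> vcarrier E) \<and>
     (\<forall>e>0. \<exists>k. \<forall>m\<ge>k. \<forall>n\<ge>k. vdist E (X m) (X n) < e)}"

locale normed_vs =
  fixes E :: "'a nspace"
  assumes zero_closed [simp]: "vzero E \<in> vcarrier E"
    and add_closed [simp]: "\<lbrakk>x \<in> vcarrier E; y \<in> vcarrier E\<rbrakk> \<Longrightarrow> vadd E x y \<in> vcarrier E"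
    and scale_closed [simp]: "x \<in> vcarrier E \<Longrightarrow> vscale E a x \<in> vcarrier E"
    and add_assoc: "\<lbrakk>x \<in> vcarrier E; y \<in> vcarrier E; z \<in> vcarrier E\<rbrakk>
          \<Longrightarrow> vadd E (vadd E x y) z = vadd E x (vadd E y z)"
    and add_commute: "\<lbrakk>x \<in> vcarrier E; y \<in> vcarrier E\<rbrakk> \<Longrightarrow> vadd E x y = vadd E y x"
    and add_zero [simp]: "x \<in> vcarrier E \<Longrightarrow> vadd E x (vzero E) = x"
    and add_neg [simp]: "x \<in> vcarrier E \<Longrightarrow> vadd E x (vscale E (-1) x) = vzero E"
    and scale_add: "\<lbrakk>x \<in> vcarrier E; y \<in> vcarrier E\<rbrakk>
          \<Longrightarrow> vscale E a (vadd E x y) = vadd E (vscale E a x) (vscale E a y)"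
    and add_scale: "x \<in> vcarrier E
          \<Longrightarrow> vscale E (a + b) x = vadd E (vscale E a x) (vscale E b x)"
    and scale_scale: "x \<in> vcarrier E \<Longrightarrow> vscale E a (vscale E b x) = vscale E (a * b) x"
    and scale_one [simp]: "x \<in> vcarrier E \<Longrightarrow> vscale E 1 x = x"
    and norm_eq_0: "x \<in> vcarrier E \<Longrightarrow> vnorm E x = 0 \<longleftrightarrow> x = vzero E"
    and norm_scale: "x \<in> vcarrier E \<Longrightarrow> vnorm E (vscale E a x) = \<bar>a\<bar> * vnorm E x"
    and norm_triangle: "\<lbrakk>x \<in> vcarrier E; y \<in> vcarrier E\<rbrakk>
          \<Longrightarrow> vnorm E (vadd E x y) \<le> vnorm E x + vnorm E y"

locale banach_vs = normed_vs +
  assumes complete: "X \<in> cauchy_seqs E \<Longrightarrow> \<exists>x\<in>vcarrier E. (\<lambda>n. vdist E (X n) x) \<longlonglongrightarrow> 0"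


subsection \<open>Operators, Banach--Mazur distance, duals\<close>

definition linear_op :: "'a nspace \<Rightarrow> 'b nspace \<Rightarrow> ('a \<Rightarrow> 'b) \<Rightarrow> bool" where
  "linear_op E F U \<longleftrightarrow> U \<in> vcarrier E \<rightarrow> vcarrier F \<and>
     (\<forall>x\<in>vcarrier E. \<forall>y\<in>vcarrier E. U (vadd E x y) = vadd F (U x) (U y)) \<and>
     (\<forall>a. \<forall>x\<in>vcarrier E. U (vscale E a x) = vscale F a (U x))"

definition bounded_op :: "'a nspace \<Rightarrow> 'b nspace \<Rightarrow> ('a \<Rightarrow> 'b) \<Rightarrow> bool" where
  "bounded_op E F U \<longleftrightarrow> linear_op E F U \<and>
     (\<exists>K. \<forall>x\<in>vcarrier E. vnorm F (U x) \<le> K * vnorm E x)"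

definition op_norm :: "'a nspace \<Rightarrow> 'b nspace \<Rightarrow> ('a \<Rightarrow> 'b) \<Rightarrow> real" where
  "op_norm E F U = (SUP x\<in>{x\<in>vcarrier E. vnorm E x \<le> 1}. vnorm F (U x))"

definition isomorphism :: "'a nspace \<Rightarrow> 'b nspace \<Rightarrow> ('a \<Rightarrow> 'b) \<Rightarrow> bool" where
  "isomorphism E F U \<longleftrightarrow> bij_betw U (vcarrier E) (vcarrier F) \<and>
     bounded_op E F U \<and> bounded_op F E (inv_into (vcarrier E) U)"

definition isomorphic :: "'a nspace \<Rightarrow> 'b nspace \<Rightarrow> bool" where
  "isomorphic E F \<longleftrightarrow> (\<exists>U. isomorphism E F U)"

text \<open>The infimum is taken in \<open>ereal\<close>, so that it is \<open>\<infinity>\<close> for non-isomorphic spaces.\<close>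

definition d_BM :: "'a nspace \<Rightarrow> 'b nspace \<Rightarrow> ereal" where
  "d_BM E F = (INF U\<in>{U. isomorphism E F U}.
     ereal (op_norm E F U * op_norm F E (inv_into (vcarrier E) U)))"

definition real_line :: "real nspace" where
  "real_line = \<lparr>vcarrier = UNIV, vzero = 0, vadd = (+), vscale = (*), vnorm = abs\<rparr>"

text \<open>
  Functionals are normalised to be \<open>undefined\<close> outside the carrier of \<open>E\<close>, so that
  equality of functionals is equality of functions.
\<close>

definition dual :: "'a nspace \<Rightarrow> ('a \<Rightarrow> real) nspace" where
  "dual E = \<lparr>vcarrier = {f \<in> extensional (vcarrier E). bounded_op E real_line f},
     vzero = (\<lambda>x\<in>vcarrier E. 0),
     vadd = (\<lambda>f g. \<lambda>x\<in>vcarrier E. f x + g x),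
     vscale = (\<lambda>a f. \<lambda>x\<in>vcarrier E. a * f x),
     vnorm = op_norm E real_line\<rparr>"

definition bidual_embed :: "'a nspace \<Rightarrow> 'a \<Rightarrow> ('a \<Rightarrow> real) \<Rightarrow> real" where
  "bidual_embed E x = (\<lambda>f\<in>vcarrier (dual E). f x)"

definition reflexive :: "'a nspace \<Rightarrow> bool" where
  "reflexive E \<longleftrightarrow> bidual_embed E ` vcarrier E = vcarrier (dual (dual E))"

definition ell2_norm :: "(nat \<Rightarrow> real) \<Rightarrow> real" where
  "ell2_norm x = sqrt (\<Sum>j. (x j)\<^sup>2)"

definition ell2 :: "(nat \<Rightarrow> real) nspace" where
  "ell2 = \<lparr>vcarrier = {x. summable (\<lambda>j. (x j)\<^sup>2)},
     vzero = (\<lambda>j. 0),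
     vadd = (\<lambda>x y j. x j + y j),
     vscale = (\<lambda>a x j. a * x j),
     vnorm = ell2_norm\<rparr>"


subsection \<open>Completion\<close>

text \<open>Cauchy sequences modulo null sequences.\<close>

definition null_rel :: "'a nspace \<Rightarrow> ((nat \<Rightarrow> 'a) \<times> (nat \<Rightarrow> 'a)) set" where
  "null_rel E = {(X, Y). X \<in> cauchy_seqs E \<and> Y \<in> cauchy_seqs E \<and>
     (\<lambda>n. vdist E (X n) (Y n)) \<longlonglongrightarrow> 0}"

definition nspace_completion :: "'a nspace \<Rightarrow> (nat \<Rightarrow> 'a) set nspace" where
  "nspace_completion E = \<lparr>vcarrier = cauchy_seqs E // null_rel E,
     vzero = null_rel E `` {\<lambda>n. vzero E},
     vadd = (\<lambda>P Q. \<Union>X\<in>P. \<Union>Y\<in>Q. null_rel E `` {\<lambda>n. vadd E (X n) (Y n)}),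
     vscale = (\<lambda>a P. \<Union>X\<in>P. null_rel E `` {\<lambda>n. vscale E a (X n)}),
     vnorm = (\<lambda>P. THE r. \<exists>X\<in>P. (\<lambda>n. vnorm E (X n)) \<longlonglongrightarrow> r)\<rparr>"

definition completion_embed :: "'a nspace \<Rightarrow> 'a \<Rightarrow> (nat \<Rightarrow> 'a) set" where
  "completion_embed E x = null_rel E `` {\<lambda>n. x}"


section \<open>The spaces \<open>A(N\<^sub>n)\<close> and \<open>X\<^sub>c\<close>\<close>

definition is_norm2 :: "(real \<Rightarrow> real \<Rightarrow> real) \<Rightarrow> bool" where
  "is_norm2 N \<longleftrightarrow>
     (\<forall>s t. N s t = 0 \<longleftrightarrow> s = 0 \<and> t = 0) \<and>
     (\<forall>a s t. N (a * s) (a * t) = \<bar>a\<bar> * N s t) \<and>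
     (\<forall>s t s' t'. N (s + s') (t + t') \<le> N s t + N s' t')"

definition absolute_normalized_norm :: "(real \<Rightarrow> real \<Rightarrow> real) \<Rightarrow> bool" where
  "absolute_normalized_norm N \<longleftrightarrow> is_norm2 N \<and>
     (\<forall>s t. N s t = N \<bar>s\<bar> \<bar>t\<bar>) \<and> N 1 0 = 1 \<and> N 0 1 = 1"

text \<open>
  \<open>M_norm N n x\<close> only looks at \<open>x 0, \<dots>, x n\<close>. The value \<open>N 0\<close> is never used.
\<close>

fun M_norm :: "(nat \<Rightarrow> real \<Rightarrow> real \<Rightarrow> real) \<Rightarrow> nat \<Rightarrow> (nat \<Rightarrow> real) \<Rightarrow> real" where
  "M_norm N 0 x = \<bar>x 0\<bar>"
| "M_norm N (Suc n) x = N (Suc n) (M_norm N n x) \<bar>x (Suc n)\<bar>"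

definition c00 :: "(nat \<Rightarrow> real) set" where
  "c00 = {x. finite {j. x j \<noteq> 0}}"

text \<open>Any admissible \<open>n\<close> gives the same value, see \<open>A_norm_eq_M\<close> below.\<close>

definition A_norm :: "(nat \<Rightarrow> real \<Rightarrow> real \<Rightarrow> real) \<Rightarrow> (nat \<Rightarrow> real) \<Rightarrow> real" where
  "A_norm N x = M_norm N (LEAST n. \<forall>j>n. x j = 0) x"

definition c00_space :: "(nat \<Rightarrow> real \<Rightarrow> real \<Rightarrow> real) \<Rightarrow> (nat \<Rightarrow> real) nspace" where
  "c00_space N = \<lparr>vcarrier = c00,
     vzero = (\<lambda>j. 0),
     vadd = (\<lambda>x y j. x j + y j),
     vscale = (\<lambda>a x j. a * x j),
     vnorm = A_norm N\<rparr>"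

definition A_space :: "(nat \<Rightarrow> real \<Rightarrow> real \<Rightarrow> real) \<Rightarrow> (nat \<Rightarrow> nat \<Rightarrow> real) set nspace" where
  "A_space N = nspace_completion (c00_space N)"

definition Nc :: "real \<Rightarrow> nat \<Rightarrow> real \<Rightarrow> real \<Rightarrow> real" where
  "Nc c n s t = root (2 * n) ((1 - c ^ (2 * n)) * \<bar>t\<bar> ^ (2 * n) + (s\<^sup>2 + c\<^sup>2 * t\<^sup>2) ^ n)"

definition X_norm :: "real \<Rightarrow> (nat \<Rightarrow> real) \<Rightarrow> real" where
  "X_norm c = A_norm (Nc c)"

definition X_space :: "real \<Rightarrow> (nat \<Rightarrow> nat \<Rightarrow> real) set nspace" where
  "X_space c = A_space (Nc c)"

subsection \<open>The norms on \<open>c\<^sub>0\<^sub>0\<close>\<close>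

lemma absnorm_nonneg:
  assumes "absolute_normalized_norm N"
  shows "0 \<le> N s t"
proof -
  have z: "N 0 0 = 0" and tr: "N (s + - s) (t + - t) \<le> N s t + N (- s) (- t)"
    using assms unfolding absolute_normalized_norm_def is_norm2_def by blast+
  have "N (-s) (-t) = N \<bar>-s\<bar> \<bar>-t\<bar>" "N s t = N \<bar>s\<bar> \<bar>t\<bar>"
    using assms unfolding absolute_normalized_norm_def by blast+
  then have "N (-s) (-t) = N s t" by simp
  with z tr show ?thesis by simp
qed

lemma absnorm_hom: "absolute_normalized_norm N \<Longrightarrow> N (a * s) (a * t) = \<bar>a\<bar> * N s t"
  unfolding absolute_normalized_norm_def is_norm2_def by blast

lemma absnorm_eq_0: "absolute_normalized_norm N \<Longrightarrow> N s t = 0 \<longleftrightarrow> s = 0 \<and> t = 0"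
  unfolding absolute_normalized_norm_def is_norm2_def by blast

lemma absnorm_triangle:
  "absolute_normalized_norm N \<Longrightarrow> N (s + s') (t + t') \<le> N s t + N s' t'"
  unfolding absolute_normalized_norm_def is_norm2_def by blast

lemma absnorm_right_0:
  assumes "absolute_normalized_norm N"
  shows "N s 0 = \<bar>s\<bar>"
proof -
  have "N (s * 1) (s * 0) = \<bar>s\<bar> * N 1 0" and "N 1 0 = 1"
    using assms unfolding absolute_normalized_norm_def is_norm2_def by blast+
  then show ?thesis by simp
qed

lemma absnorm_mono1:
  assumes N: "absolute_normalized_norm N" and "0 \<le> s" "s \<le> s'"
  shows "N s t \<le> N s' t"
proof (cases "s' = 0")
  case True
  with assms show ?thesis by simp
next
  case False
  with assms have pos: "s' > 0" by simp
  define l where "l = (1 + s / s') / 2"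
  have l: "0 \<le> l" "l \<le> 1" using assms pos by (auto simp: l_def field_simps)
  have tr: "N (l * s' + (1 - l) * (- s')) (l * t + (1 - l) * t)
      \<le> N (l * s') (l * t) + N ((1 - l) * (- s')) ((1 - l) * t)"
   and h: "N (l * s') (l * t) = \<bar>l\<bar> * N s' t"
     "N ((1 - l) * (- s')) ((1 - l) * t) = \<bar>1 - l\<bar> * N (- s') t"
    using N unfolding absolute_normalized_norm_def is_norm2_def by blast+
  have "N (-s') t = N \<bar>-s'\<bar> \<bar>t\<bar>" "N s' t = N \<bar>s'\<bar> \<bar>t\<bar>"
    using N unfolding absolute_normalized_norm_def by blast+
  then have e: "N (- s') t = N s' t" by simp
  have "l * s' + (1 - l) * (- s') = s" "l * t + (1 - l) * t = t"
    using pos by (simp_all add: l_def field_simps)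
  with tr h e l have "N s t \<le> l * N s' t + (1 - l) * N s' t" by simp
  then show ?thesis by (simp add: algebra_simps)
qed

lemma absnorm_mono2:
  assumes N: "absolute_normalized_norm N" and "0 \<le> t" "t \<le> t'"
  shows "N s t \<le> N s t'"
proof -
  have "absolute_normalized_norm (\<lambda>s t. N t s)"
    using N unfolding absolute_normalized_norm_def is_norm2_def by metis
  from absnorm_mono1[OF this assms(2,3)] show ?thesis .
qed

context
  fixes N :: "nat \<Rightarrow> real \<Rightarrow> real \<Rightarrow> real"
  assumes N: "\<And>n. n \<ge> 1 \<Longrightarrow> absolute_normalized_norm (N n)"
begin

lemma absnorm_Suc: "absolute_normalized_norm (N (Suc n))"
  by (simp add: N)

lemma M_nonneg: "0 \<le> M_norm N n x"
proof (cases n)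
  case (Suc k)
  show ?thesis unfolding Suc M_norm.simps by (rule absnorm_nonneg[OF absnorm_Suc])
qed simp

lemma M_eq:
  assumes "\<forall>j>m. x j = 0" "m \<le> n"
  shows "M_norm N n x = M_norm N m x"
  using assms(2)
proof (induction n rule: dec_induct)
  case base
  show ?case by simp
next
  case (step n)
  have "x (Suc n) = 0" using assms(1) step.hyps by simp
  then have "M_norm N (Suc n) x = \<bar>M_norm N n x\<bar>" by (simp add: absnorm_right_0[OF absnorm_Suc])
  then show ?case using step.IH by (simp add: M_nonneg)
qed

lemma A_norm_eq_M:
  assumes "\<forall>j>n. x j = 0"
  shows "A_norm N x = M_norm N n x"
proof -
  let ?m = "LEAST n. \<forall>j>n. x j = 0"
  have "?m \<le> n" by (rule Least_le) (rule assms)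
  moreover have "\<forall>j>?m. x j = 0" by (rule LeastI) (rule assms)
  ultimately have "M_norm N n x = M_norm N ?m x" by (intro M_eq)
  then show ?thesis by (simp only: A_norm_def)
qed

lemma M_scale: "M_norm N n (\<lambda>j. a * x j) = \<bar>a\<bar> * M_norm N n x"
proof (induction n)
  case (Suc n)
  have "N (Suc n) (\<bar>a\<bar> * M_norm N n x) (\<bar>a\<bar> * \<bar>x (Suc n)\<bar>)
      = \<bar>\<bar>a\<bar>\<bar> * N (Suc n) (M_norm N n x) \<bar>x (Suc n)\<bar>"
    by (rule absnorm_hom[OF absnorm_Suc])
  then show ?case using Suc by (simp add: abs_mult)
qed (simp add: abs_mult)

lemma M_triangle: "M_norm N n (\<lambda>j. x j + y j) \<le> M_norm N n x + M_norm N n y"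
proof (induction n)
  case (Suc n)
  let ?N = "N (Suc n)"
  have a: "absolute_normalized_norm ?N" by (simp add: N)
  have "M_norm N (Suc n) (\<lambda>j. x j + y j)
      \<le> ?N (M_norm N n x + M_norm N n y) \<bar>x (Suc n) + y (Suc n)\<bar>"
    using absnorm_mono1[OF a M_nonneg Suc] by simp
  also have "\<dots> \<le> ?N (M_norm N n x + M_norm N n y) (\<bar>x (Suc n)\<bar> + \<bar>y (Suc n)\<bar>)"
    by (rule absnorm_mono2[OF a]) auto
  also have "\<dots> \<le> ?N (M_norm N n x) \<bar>x (Suc n)\<bar> + ?N (M_norm N n y) \<bar>y (Suc n)\<bar>"
    by (rule absnorm_triangle[OF a])
  finally show ?case by simp
qed simp

lemma M_eq_0: "M_norm N n x = 0 \<longleftrightarrow> (\<forall>j\<le>n. x j = 0)"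
proof (induction n)
  case (Suc n)
  have "M_norm N (Suc n) x = 0 \<longleftrightarrow> M_norm N n x = 0 \<and> \<bar>x (Suc n)\<bar> = 0"
    by (simp add: absnorm_eq_0[OF absnorm_Suc])
  then show ?case unfolding Suc le_Suc_eq by auto
qed simp

lemma c00_bound:
  assumes "x \<in> c00"
  obtains m where "\<And>n. m \<le> n \<Longrightarrow> \<forall>j>n. x j = 0"
proof -
  obtain m where "\<forall>j\<in>{j. x j \<noteq> 0}. j \<le> m"
    using assms unfolding c00_def by (metis finite_nat_set_iff_bounded_le mem_Collect_eq)
  then have "\<And>n. m \<le> n \<Longrightarrow> \<forall>j>n. x j = 0"
    using le_trans not_le by blast
  then show ?thesis by (rule that)
qed

lemma normed_vs_c00_space: "normed_vs (c00_space N)"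
proof
  fix x y :: "nat \<Rightarrow> real" and a :: real
  show "vzero (c00_space N) \<in> vcarrier (c00_space N)"
    by (simp add: c00_space_def c00_def)
  show "x \<in> vcarrier (c00_space N) \<Longrightarrow> vscale (c00_space N) a x \<in> vcarrier (c00_space N)"
    by (auto simp: c00_space_def c00_def elim: rev_finite_subset)
  show "vadd (c00_space N) x y \<in> vcarrier (c00_space N)"
    if "x \<in> vcarrier (c00_space N)" "y \<in> vcarrier (c00_space N)"
  proof -
    have "finite ({j. x j \<noteq> 0} \<union> {j. y j \<noteq> 0})"
      using that by (simp add: c00_space_def c00_def)
    then have "finite {j. x j + y j \<noteq> 0}" by (rule rev_finite_subset) auto
    then show ?thesis by (simp add: c00_space_def c00_def)
  qed
  assume "x \<in> vcarrier (c00_space N)"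
  then have x: "x \<in> c00" by (simp add: c00_space_def)
  then obtain m where m: "\<And>n. m \<le> n \<Longrightarrow> \<forall>j>n. x j = 0" using c00_bound by blast
  have "A_norm N x = M_norm N m x" using A_norm_eq_M m by blast
  moreover have "(\<forall>j\<le>m. x j = 0) \<longleftrightarrow> x = (\<lambda>j. 0)" using m[of m] le_less_linear unfolding fun_eq_iff by blast
  ultimately show "vnorm (c00_space N) x = 0 \<longleftrightarrow> x = vzero (c00_space N)"
    by (simp add: c00_space_def M_eq_0)
  have "A_norm N (\<lambda>j. a * x j) = M_norm N m (\<lambda>j. a * x j)" by (rule A_norm_eq_M) (use m[of m] in simp)
  then show "vnorm (c00_space N) (vscale (c00_space N) a x) = \<bar>a\<bar> * vnorm (c00_space N) x"
    using \<open>A_norm N x = M_norm N m x\<close> by (simp add: c00_space_def M_scale)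
  assume "y \<in> vcarrier (c00_space N)"
  then have "y \<in> c00" by (simp add: c00_space_def)
  then obtain m' where m': "\<And>n. m' \<le> n \<Longrightarrow> \<forall>j>n. y j = 0" using c00_bound by blast
  let ?k = "max m m'"
  have "A_norm N x = M_norm N ?k x" "A_norm N y = M_norm N ?k y"
    "A_norm N (\<lambda>j. x j + y j) = M_norm N ?k (\<lambda>j. x j + y j)"
    by (rule A_norm_eq_M; use m[of ?k] m'[of ?k] in simp)+
  then show "vnorm (c00_space N) (vadd (c00_space N) x y)
      \<le> vnorm (c00_space N) x + vnorm (c00_space N) y"
    by (simp add: c00_space_def M_triangle)
qed (simp_all add: c00_space_def distrib_left distrib_right add_ac mult.assoc)

end

lemma minkowski2:
  fixes a b a' b' :: real
  assumes p: "p > 0" and nn: "0 \<le> a" "0 \<le> b" "0 \<le> a'" "0 \<le> b'"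
  shows "root p ((a + a') ^ p + (b + b') ^ p) \<le> root p (a ^ p + b ^ p) + root p (a' ^ p + b' ^ p)"
proof -
  define u where "u = root p (a ^ p + b ^ p)"
  define v where "v = root p (a' ^ p + b' ^ p)"
  have u: "u ^ p = a ^ p + b ^ p" "0 \<le> u" and v: "v ^ p = a' ^ p + b' ^ p" "0 \<le> v"
    using p nn by (simp_all add: u_def v_def)
  have "(a + a') ^ p + (b + b') ^ p \<le> (u + v) ^ p"
  proof (cases "u = 0 \<or> v = 0")
    case True
    then have "(a = 0 \<and> b = 0) \<or> (a' = 0 \<and> b' = 0)"
      using u v p nn by (auto simp: power_0_left add_nonneg_eq_0_iff)
    with u v show ?thesis using True p by (auto simp: power_0_left)
  next
    case False
    with u v have pos: "u > 0" "v > 0" by auto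
    define l where "l = v / (u + v)"
    have l: "0 \<le> l" "l \<le> 1" "1 - l = u / (u + v)" using pos by (auto simp: l_def field_simps)
    have conv: "((x + y) / (u + v)) ^ p \<le> (1 - l) * (x / u) ^ p + l * (y / v) ^ p"
      if "0 \<le> x" "0 \<le> y" for x y
    proof -
      have "convex_on {0::real..} (\<lambda>x. x ^ p)"
        using convex_power_even convex_power_odd
        by (metis convex_on_subset top_greatest convex_real_interval(1))
      from convex_onD[OF this, of l "x / u" "y / v"] l pos that
      have "((1 - l) * (x / u) + l * (y / v)) ^ p \<le> (1 - l) * (x / u) ^ p + l * (y / v) ^ p"
        by simp
      moreover have "(1 - l) * (x / u) + l * (y / v) = (x + y) / (u + v)"
        using pos unfolding l(3) unfolding l_def by (simp add: add_divide_distrib)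
      ultimately show ?thesis by simp
    qed
    have "((a + a') / (u + v)) ^ p + ((b + b') / (u + v)) ^ p
        \<le> (1 - l) * ((a / u) ^ p + (b / u) ^ p) + l * ((a' / v) ^ p + (b' / v) ^ p)"
      using conv[of a a'] conv[of b b'] nn by (simp add: algebra_simps)
    also have "(a / u) ^ p + (b / u) ^ p = 1"
      using pos by (simp add: power_divide flip: add_divide_distrib u(1))
    also have "(a' / v) ^ p + (b' / v) ^ p = 1"
      using pos by (simp add: power_divide flip: add_divide_distrib v(1))
    finally show ?thesis
      using pos by (simp add: power_divide field_simps)
  qed
  then have "root p ((a + a') ^ p + (b + b') ^ p) \<le> root p ((u + v) ^ p)"
    using p by simp
  also have "\<dots> = u + v" using p u v by (simp add: real_root_power_cancel)
  finally show ?thesis by (simp add: u_def v_def)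
qed

lemma absolute_normalized_norm_Nc:
  assumes c: "0 < c" "c < 1" and n: "n \<ge> 1"
  shows "absolute_normalized_norm (Nc c n)"
proof -
  define p where "p = 2 * n"
  have p: "p > 0" using n by (simp add: p_def)
  define k where "k = root p (1 - c ^ p)"
  have "c ^ p < 1" using c p by (simp add: power_less_one_iff)
  then have k: "k > 0" "k ^ p = 1 - c ^ p" using p by (simp_all add: k_def)
  define q where "q s t = norm (s, c * t)" for s t :: real
  have q: "q s t ^ p = (s\<^sup>2 + c\<^sup>2 * t\<^sup>2) ^ n" "0 \<le> q s t" for s t
    by (simp_all add: q_def p_def norm_Pair power_mult power_mult_distrib)
  have eq: "Nc c n s t = root p ((k * \<bar>t\<bar>) ^ p + q s t ^ p)" for s t
    by (simp add: Nc_def q k(2) power_mult_distrib flip: p_def)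
  have mono: "root p (x ^ p + y ^ p) \<le> root p (x' ^ p + y' ^ p)"
    if "0 \<le> x" "x \<le> x'" "0 \<le> y" "y \<le> y'" for x y x' y' :: real
    using p that by (simp add: add_mono power_mono)
  have tri: "Nc c n (s + s') (t + t') \<le> Nc c n s t + Nc c n s' t'" for s t s' t'
  proof -
    have "q (s + s') (t + t') \<le> q s t + q s' t'"
      using norm_triangle_ineq[of "(s, c * t)" "(s', c * t')"] by (simp add: q_def distrib_left)
    then have "Nc c n (s + s') (t + t')
        \<le> root p ((k * \<bar>t\<bar> + k * \<bar>t'\<bar>) ^ p + (q s t + q s' t') ^ p)"
      unfolding eq using k q by (intro mono) (auto simp flip: distrib_left)
    also have "\<dots> \<le> Nc c n s t + Nc c n s' t'"
      unfolding eq using k q by (intro minkowski2 p) auto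
    finally show ?thesis .
  qed
  have hom: "Nc c n (a * s) (a * t) = \<bar>a\<bar> * Nc c n s t" for a s t
  proof -
    have "q (a * s) (a * t) = norm (a *\<^sub>R (s, c * t))" by (simp add: q_def mult.left_commute)
    then have "q (a * s) (a * t) = \<bar>a\<bar> * q s t" unfolding norm_scaleR by (simp add: q_def)
    then have "(k * \<bar>a * t\<bar>) ^ p + q (a * s) (a * t) ^ p = \<bar>a\<bar> ^ p * ((k * \<bar>t\<bar>) ^ p + q s t ^ p)"
      by (simp add: abs_mult power_mult_distrib algebra_simps)
    then show ?thesis unfolding eq using p by (simp add: real_root_mult real_root_power_cancel)
  qed
  have zero: "Nc c n s t = 0 \<longleftrightarrow> s = 0 \<and> t = 0" for s t
  proof -
    have "Nc c n s t = 0 \<longleftrightarrow> (k * \<bar>t\<bar>) ^ p + q s t ^ p = 0"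
      unfolding eq using p by simp
    also have "\<dots> \<longleftrightarrow> (k * \<bar>t\<bar>) ^ p = 0 \<and> q s t ^ p = 0"
      by (rule add_nonneg_eq_0_iff) (use k q in auto)
    also have "\<dots> \<longleftrightarrow> s = 0 \<and> t = 0"
      using p k c by (auto simp: q_def norm_Pair)
    finally show ?thesis .
  qed
  have "Nc c n s t = Nc c n \<bar>s\<bar> \<bar>t\<bar>" for s t by (simp add: Nc_def)
  moreover have "Nc c n 1 0 = 1" "Nc c n 0 1 = 1"
    using n by (simp_all add: Nc_def power_mult)
  ultimately show ?thesis
    unfolding absolute_normalized_norm_def is_norm2_def using tri hom zero by blast
qed



subsection \<open>The completion is a Banach space containing \<open>E\<close> as a dense subspace\<close>

context normed_vs
begin

abbreviation "V \<equiv> vcarrier E"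
abbreviation "C \<equiv> cauchy_seqs E"

lemma scale_zero: "x \<in> V \<Longrightarrow> vscale E 0 x = vzero E"
  using add_scale[of x 1 "-1"] by simp

lemma norm_zero [simp]: "vnorm E (vzero E) = 0"
  by (simp add: norm_eq_0)

lemma norm_nonneg: assumes "x \<in> V" shows "0 \<le> vnorm E x"
  using norm_triangle[of x "vscale E (-1) x"] assms by (simp add: norm_scale)

lemma zero_add [simp]: "x \<in> V \<Longrightarrow> vadd E (vzero E) x = x"
  using add_commute[of x "vzero E"] by simp

lemma neg_add [simp]: "x \<in> V \<Longrightarrow> vadd E (vscale E (-1) x) x = vzero E"
  using add_commute[of x "vscale E (-1) x"] by simp

lemma add_left_commute:
  "\<lbrakk>x \<in> V; y \<in> V; z \<in> V\<rbrakk> \<Longrightarrow> vadd E x (vadd E y z) = vadd E y (vadd E x z)"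
  using add_assoc[of x y z] add_assoc[of y x z] add_commute[of x y] by simp

lemma neg_neg [simp]: "x \<in> V \<Longrightarrow> vscale E (-1) (vscale E (-1) x) = x"
  by (simp add: scale_scale)

lemma cancel_mid: "\<lbrakk>x \<in> V; y \<in> V; z \<in> V\<rbrakk> \<Longrightarrow>
    vadd E (vadd E x (vscale E (-1) y)) (vadd E y z) = vadd E x z"
  using add_assoc[of "vscale E (-1) y" y z] by (simp add: add_assoc)

lemma vdist_nonneg: "\<lbrakk>x \<in> V; y \<in> V\<rbrakk> \<Longrightarrow> 0 \<le> vdist E x y"
  by (simp add: vdist_def norm_nonneg)

lemma vdist_self [simp]: "x \<in> V \<Longrightarrow> vdist E x x = 0"
  by (simp add: vdist_def)

lemma vdist_zero_right: "x \<in> V \<Longrightarrow> vdist E x (vzero E) = vnorm E x"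
proof -
  have "vscale E (-1) (vzero E) = vzero E"
    using zero_add[of "vscale E (-1) (vzero E)"] add_neg[of "vzero E"] by simp
  then show "x \<in> V \<Longrightarrow> vdist E x (vzero E) = vnorm E x" by (simp add: vdist_def)
qed

lemma vdist_triangle:
  "\<lbrakk>x \<in> V; y \<in> V; z \<in> V\<rbrakk> \<Longrightarrow> vdist E x z \<le> vdist E x y + vdist E y z"
  using norm_triangle[of "vadd E x (vscale E (-1) y)" "vadd E y (vscale E (-1) z)"]
  by (simp add: vdist_def cancel_mid)

lemma vdist_scale:
  "\<lbrakk>x \<in> V; y \<in> V\<rbrakk> \<Longrightarrow> vdist E (vscale E a x) (vscale E a y) = \<bar>a\<bar> * vdist E x y"
proof -
  assume xy: "x \<in> V" "y \<in> V"
  have "vscale E (-1) (vscale E a y) = vscale E a (vscale E (-1) y)"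
    using xy by (simp add: scale_scale)
  then have "vdist E (vscale E a x) (vscale E a y)
      = vnorm E (vscale E a (vadd E x (vscale E (-1) y)))"
    unfolding vdist_def using xy by (simp add: scale_add)
  then show ?thesis using xy by (simp add: norm_scale vdist_def)
qed

lemma vdist_commute: assumes xy: "x \<in> V" "y \<in> V" shows "vdist E x y = vdist E y x"
proof -
  have "vscale E (-1) (vadd E x (vscale E (-1) y)) = vadd E y (vscale E (-1) x)"
    using xy add_commute[of "vscale E (-1) x" y] by (simp add: scale_add)
  then show ?thesis
    unfolding vdist_def using norm_scale[of "vadd E x (vscale E (-1) y)" "-1"] xy by simp
qed

lemma vdist_add:
  assumes "x \<in> V" "y \<in> V" "x' \<in> V" "y' \<in> V"
  shows "vdist E (vadd E x x') (vadd E y y') \<le> vdist E x y + vdist E x' y'"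
proof -
  have "vadd E (vadd E x x') (vscale E (-1) (vadd E y y'))
      = vadd E (vadd E x (vscale E (-1) y)) (vadd E x' (vscale E (-1) y'))"
    using assms by (simp add: scale_add add_assoc add_left_commute)
  then show ?thesis
    unfolding vdist_def
    using norm_triangle[of "vadd E x (vscale E (-1) y)" "vadd E x' (vscale E (-1) y')"] assms
    by simp
qed

lemma norm_diff: assumes "x \<in> V" "y \<in> V" shows "\<bar>vnorm E x - vnorm E y\<bar> \<le> vdist E x y"
  using vdist_triangle[of x y "vzero E"] vdist_triangle[of y x "vzero E"]
    vdist_commute[of x y] assms
  by (simp add: vdist_zero_right)

lemma C_closed: "X \<in> C \<Longrightarrow> X n \<in> V"
  by (simp add: cauchy_seqs_def)

lemma C_D: "\<lbrakk>X \<in> C; 0 < e\<rbrakk> \<Longrightarrow> \<exists>k. \<forall>m\<ge>k. \<forall>n\<ge>k. vdist E (X m) (X n) < e"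
  by (simp add: cauchy_seqs_def)

lemma C_const: "x \<in> V \<Longrightarrow> (\<lambda>n. x) \<in> C"
  by (simp add: cauchy_seqs_def)

lemma C_add: assumes X: "X \<in> C" and Y: "Y \<in> C" shows "(\<lambda>n. vadd E (X n) (Y n)) \<in> C"
  unfolding cauchy_seqs_def
proof (intro CollectI conjI allI impI)
  show "vadd E (X i) (Y i) \<in> V" for i using C_closed X Y by simp
  fix e :: real assume "e > 0"
  then obtain k l where k: "\<forall>m\<ge>k. \<forall>n\<ge>k. vdist E (X m) (X n) < e / 2"
    and l: "\<forall>m\<ge>l. \<forall>n\<ge>l. vdist E (Y m) (Y n) < e / 2"
    using C_D[OF X, of "e/2"] C_D[OF Y, of "e/2"] by auto
  have "vdist E (vadd E (X m) (Y m)) (vadd E (X n) (Y n)) < e"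
    if "m \<ge> max k l" "n \<ge> max k l" for m n
  proof -
    have "vdist E (X m) (X n) < e / 2" "vdist E (Y m) (Y n) < e / 2" using k l that by auto
    then show ?thesis
      using vdist_add[of "X m" "X n" "Y m" "Y n"] C_closed[OF X] C_closed[OF Y] by fastforce
  qed
  then show "\<exists>k. \<forall>m\<ge>k. \<forall>n\<ge>k. vdist E (vadd E (X m) (Y m)) (vadd E (X n) (Y n)) < e" by blast
qed

lemma C_scale: assumes X: "X \<in> C" shows "(\<lambda>n. vscale E a (X n)) \<in> C"
  unfolding cauchy_seqs_def
proof (intro CollectI conjI allI impI)
  show "vscale E a (X i) \<in> V" for i using C_closed X by simp
  fix e :: real assume e: "e > 0"
  then obtain k where k: "\<forall>m\<ge>k. \<forall>n\<ge>k. vdist E (X m) (X n) < e / (\<bar>a\<bar> + 1)"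
    using C_D[OF X, of "e / (\<bar>a\<bar> + 1)"] by auto
  have "vdist E (vscale E a (X m)) (vscale E a (X n)) < e" if "m \<ge> k" "n \<ge> k" for m n
  proof -
    have "vdist E (X m) (X n) * (\<bar>a\<bar> + 1) < e"
      using k that by (simp add: pos_less_divide_eq)
    then show ?thesis
      using vdist_nonneg[of "X m" "X n"] C_closed[OF X]
      by (simp add: vdist_scale algebra_simps) 
  qed
  then show "\<exists>k. \<forall>m\<ge>k. \<forall>n\<ge>k. vdist E (vscale E a (X m)) (vscale E a (X n)) < e" by blast
qed

lemma C_norm_convergent: assumes X: "X \<in> C" shows "convergent (\<lambda>n. vnorm E (X n))"
proof -
  have "Cauchy (\<lambda>n. vnorm E (X n))"
    unfolding Cauchy_def dist_real_def
    using C_D[OF X] norm_diff C_closed[OF X] by (meson order_le_less_trans)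
  then show ?thesis by (simp add: Cauchy_convergent_iff)
qed

lemma vdist_tendsto_0:
  assumes "\<And>n. X n \<in> V" "\<And>n. Y n \<in> V"
    "\<And>n. vdist E (X n) (Y n) \<le> f n" "f \<longlonglongrightarrow> 0"
  shows "(\<lambda>n. vdist E (X n) (Y n)) \<longlonglongrightarrow> 0"
  by (rule real_tendsto_sandwich[OF _ _ tendsto_const assms(4)]) (auto simp: assms vdist_nonneg)

lemma equiv_null_rel: "equiv C (null_rel E)"
proof (rule equivI)
  show "null_rel E \<subseteq> C \<times> C" by (auto simp: null_rel_def)
  show "refl_on C (null_rel E)"
    by (auto simp: refl_on_def null_rel_def C_closed)
  show "sym (null_rel E)"
    by (auto simp: sym_def null_rel_def C_closed vdist_commute)
  show "trans (null_rel E)"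
  proof (rule transI)
    fix X Y Z assume "(X, Y) \<in> null_rel E" "(Y, Z) \<in> null_rel E"
    then have C: "X \<in> C" "Y \<in> C" "Z \<in> C" and l: "(\<lambda>n. vdist E (X n) (Y n)) \<longlonglongrightarrow> 0"
      "(\<lambda>n. vdist E (Y n) (Z n)) \<longlonglongrightarrow> 0"
      by (auto simp: null_rel_def)
    have "(\<lambda>n. vdist E (X n) (Z n)) \<longlonglongrightarrow> 0"
    proof (rule vdist_tendsto_0)
      show "vdist E (X n) (Z n) \<le> vdist E (X n) (Y n) + vdist E (Y n) (Z n)" for n
        using C by (simp add: C_closed vdist_triangle)
    qed (use C l tendsto_add[OF l] in \<open>auto simp: C_closed\<close>)
    with C show "(X, Z) \<in> null_rel E" by (simp add: null_rel_def)
  qed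
qed

abbreviation cls where "cls X \<equiv> null_rel E `` {X}"

lemma cls_eq_iff:
  "\<lbrakk>X \<in> C; Y \<in> C\<rbrakk> \<Longrightarrow> cls X = cls Y \<longleftrightarrow> (\<lambda>n. vdist E (X n) (Y n)) \<longlonglongrightarrow> 0"
  using equiv_null_rel by (simp add: eq_equiv_class_iff) (simp add: null_rel_def)

lemma completion_carrier: "vcarrier (nspace_completion E) = cls ` C"
  by (auto simp: nspace_completion_def quotient_def)

lemma completion_zero: "vzero (nspace_completion E) = cls (\<lambda>n. vzero E)"
  by (simp add: nspace_completion_def)

lemma completion_add:
  assumes "X \<in> C" "Y \<in> C"
  shows "vadd (nspace_completion E) (cls X) (cls Y) = cls (\<lambda>n. vadd E (X n) (Y n))"
proof -
  have "congruent2 (null_rel E) (null_rel E) (\<lambda>X Y. cls (\<lambda>n. vadd E (X n) (Y n)))"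
  proof (rule congruent2I')
    fix X X' Y Y' assume "(X, X') \<in> null_rel E" "(Y, Y') \<in> null_rel E"
    then have c: "X \<in> C" "X' \<in> C" "Y \<in> C" "Y' \<in> C"
      and l: "(\<lambda>n. vdist E (X n) (X' n)) \<longlonglongrightarrow> 0" "(\<lambda>n. vdist E (Y n) (Y' n)) \<longlonglongrightarrow> 0"
      by (auto simp: null_rel_def)
    have "(\<lambda>n. vdist E (vadd E (X n) (Y n)) (vadd E (X' n) (Y' n))) \<longlonglongrightarrow> 0"
      by (rule vdist_tendsto_0[where f = "\<lambda>n. vdist E (X n) (X' n) + vdist E (Y n) (Y' n)"])
        (use c tendsto_add[OF l] in \<open>auto simp: C_closed vdist_add\<close>)
    then show "cls (\<lambda>n. vadd E (X n) (Y n)) = cls (\<lambda>n. vadd E (X' n) (Y' n))"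
      using c by (simp add: cls_eq_iff C_add)
  qed
  from UN_equiv_class2[OF equiv_null_rel equiv_null_rel this assms]
  show ?thesis by (simp add: nspace_completion_def)
qed

lemma completion_scale:
  assumes "X \<in> C"
  shows "vscale (nspace_completion E) a (cls X) = cls (\<lambda>n. vscale E a (X n))"
proof -
  have "congruent (null_rel E) (\<lambda>X. cls (\<lambda>n. vscale E a (X n)))"
  proof (rule congruentI)
    fix X X' assume "(X, X') \<in> null_rel E"
    then have c: "X \<in> C" "X' \<in> C" and l: "(\<lambda>n. vdist E (X n) (X' n)) \<longlonglongrightarrow> 0"
      by (auto simp: null_rel_def)
    have "(\<lambda>n. vdist E (vscale E a (X n)) (vscale E a (X' n))) \<longlonglongrightarrow> 0"
      by (rule vdist_tendsto_0[where f = "\<lambda>n. \<bar>a\<bar> * vdist E (X n) (X' n)"])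
        (use c tendsto_mult_right_zero[OF l] in \<open>auto simp: C_closed vdist_scale\<close>)
    then show "cls (\<lambda>n. vscale E a (X n)) = cls (\<lambda>n. vscale E a (X' n))"
      using c by (simp add: cls_eq_iff C_scale)
  qed
  from UN_equiv_class[OF equiv_null_rel this assms]
  show ?thesis by (simp add: nspace_completion_def)
qed

lemma completion_norm:
  assumes X: "X \<in> C" and lim: "(\<lambda>n. vnorm E (X n)) \<longlonglongrightarrow> r"
  shows "vnorm (nspace_completion E) (cls X) = r"
proof -
  have "(\<lambda>n. vnorm E (Y n)) \<longlonglongrightarrow> r" if "Y \<in> cls X" for Y
  proof -
    have Y: "Y \<in> C" and l: "(\<lambda>n. vdist E (X n) (Y n)) \<longlonglongrightarrow> 0"
      using that by (auto simp: null_rel_def)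
    have "(\<lambda>n. vnorm E (X n) - vnorm E (Y n)) \<longlonglongrightarrow> 0"
      by (rule Lim_null_comparison[OF _ l]) (auto simp: norm_diff C_closed X Y)
    from tendsto_diff[OF lim this] show ?thesis by simp
  qed
  moreover have "X \<in> cls X" using equiv_null_rel X by (rule equiv_class_self)
  ultimately show ?thesis
    unfolding nspace_completion_def using LIMSEQ_unique by (auto intro!: the_equality)
qed

lemma completion_norm_lim:
  assumes "X \<in> C"
  shows "(\<lambda>n. vnorm E (X n)) \<longlonglongrightarrow> vnorm (nspace_completion E) (cls X)"
  using C_norm_convergent[OF assms] completion_norm[OF assms] by (auto simp: convergent_def)

lemma normed_vs_completion: "normed_vs (nspace_completion E)"
proof
  let ?F = "nspace_completion E"
  note simps = completion_carrier completion_zero completion_add completion_scale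
    C_add C_scale C_const C_closed
  show "vzero ?F \<in> vcarrier ?F" by (simp add: simps)
  fix P assume "P \<in> vcarrier ?F"
  then obtain X where X: "X \<in> C" and P: "P = cls X" by (auto simp: completion_carrier)
  show "vadd ?F P (vzero ?F) = P" "vadd ?F P (vscale ?F (-1) P) = vzero ?F"
    "vscale ?F 1 P = P" for a b
    using X by (simp_all add: P simps)
  show "vscale ?F a P \<in> vcarrier ?F" "vscale ?F a (vscale ?F b P) = vscale ?F (a * b) P"
    "vscale ?F (a + b) P = vadd ?F (vscale ?F a P) (vscale ?F b P)" for a b
    using X by (simp_all add: P simps scale_scale add_scale)
  have "vnorm ?F P = 0 \<longleftrightarrow> (\<lambda>n. vnorm E (X n)) \<longlonglongrightarrow> 0"
    unfolding P using completion_norm_lim[OF X] completion_norm[OF X, of 0] by metis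
  also have "\<dots> \<longleftrightarrow> P = vzero ?F"
    using X by (simp add: P completion_zero cls_eq_iff C_const vdist_zero_right C_closed)
  finally show "vnorm ?F P = 0 \<longleftrightarrow> P = vzero ?F" .
  show "vnorm ?F (vscale ?F a P) = \<bar>a\<bar> * vnorm ?F P" for a
  proof -
    have "(\<lambda>n. vnorm E (vscale E a (X n))) \<longlonglongrightarrow> \<bar>a\<bar> * vnorm ?F P"
      using tendsto_mult_left[OF completion_norm_lim[OF X]] X by (simp add: norm_scale C_closed P)
    then show ?thesis using X by (simp add: P completion_scale completion_norm C_scale)
  qed
  fix Q assume "Q \<in> vcarrier ?F"
  then obtain Y where Y: "Y \<in> C" and Q: "Q = cls Y" by (auto simp: completion_carrier)
  show "vadd ?F P Q \<in> vcarrier ?F" using X Y by (simp add: P Q simps)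
  show "vadd ?F P Q = vadd ?F Q P" 
    using X Y by (simp add: P Q simps add_commute)
  show "vscale ?F a (vadd ?F P Q) = vadd ?F (vscale ?F a P) (vscale ?F a Q)" for a
    using X Y by (simp add: P Q simps scale_add)
  show "vnorm ?F (vadd ?F P Q) \<le> vnorm ?F P + vnorm ?F Q"
  proof (rule LIMSEQ_le)
    show "(\<lambda>n. vnorm E (vadd E (X n) (Y n))) \<longlonglongrightarrow> vnorm ?F (vadd ?F P Q)"
      using completion_norm_lim[OF C_add[OF X Y]] X Y by (simp add: P Q completion_add)
    show "(\<lambda>n. vnorm E (X n) + vnorm E (Y n)) \<longlonglongrightarrow> vnorm ?F P + vnorm ?F Q"
      unfolding P Q by (intro tendsto_add completion_norm_lim X Y)
    show "\<exists>N. \<forall>n\<ge>N. vnorm E (vadd E (X n) (Y n)) \<le> vnorm E (X n) + vnorm E (Y n)"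
      using X Y by (auto simp: norm_triangle C_closed)
  qed
  fix R assume "R \<in> vcarrier ?F"
  then obtain Z where Z: "Z \<in> C" and R: "R = cls Z" by (auto simp: completion_carrier)
  show "vadd ?F (vadd ?F P Q) R = vadd ?F P (vadd ?F Q R)"
    using X Y Z by (simp add: P Q R simps add_assoc)
qed

lemma completion_embed_linear: "linear_op E (nspace_completion E) (completion_embed E)"
  by (auto simp: linear_op_def completion_embed_def completion_carrier completion_add
      completion_scale C_const)

lemma completion_embed_norm: "x \<in> V \<Longrightarrow> vnorm (nspace_completion E) (completion_embed E x) = vnorm E x"
  unfolding completion_embed_def by (rule completion_norm) (auto simp: C_const)

lemma completion_vdist_const:
  assumes X: "X \<in> C" and x: "x \<in> V"
  shows "(\<lambda>n. vdist E (X n) x) \<longlonglongrightarrow> vdist (nspace_completion E) (cls X) (completion_embed E x)"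
  using completion_norm_lim[OF C_add[OF X C_const[of "vscale E (-1) x"]]] X x
  by (simp add: vdist_def completion_embed_def completion_add completion_scale C_const)

lemma completion_embed_dense:
  assumes P: "P \<in> vcarrier (nspace_completion E)" and e: "e > 0"
  shows "\<exists>x\<in>V. vdist (nspace_completion E) P (completion_embed E x) < e"
proof -
  obtain X where X: "X \<in> C" and P: "P = cls X" using P by (auto simp: completion_carrier)
  obtain k where k: "\<forall>m\<ge>k. \<forall>n\<ge>k. vdist E (X m) (X n) < e / 2" using C_D[OF X, of "e/2"] e by auto
  have "vdist (nspace_completion E) P (completion_embed E (X k)) \<le> e / 2"
    unfolding P
    by (rule LIMSEQ_le_const2[OF completion_vdist_const[OF X C_closed[OF X]]])
      (use k in \<open>auto intro!: exI[of _ k] less_imp_le\<close>)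
  with e have "vdist (nspace_completion E) P (completion_embed E (X k)) < e" by simp
  then show ?thesis using C_closed[OF X] by blast
qed

lemma completion_embed_vdist:
  assumes "x \<in> V" "y \<in> V"
  shows "vdist (nspace_completion E) (completion_embed E x) (completion_embed E y) = vdist E x y"
  using LIMSEQ_unique[OF completion_vdist_const[OF C_const[OF assms(1)] assms(2)] tendsto_const]
  by (simp add: completion_embed_def)

lemma banach_vs_completion: "banach_vs (nspace_completion E)"
proof -
  let ?F = "nspace_completion E" and ?J = "completion_embed E"
  interpret F: normed_vs ?F by (rule normed_vs_completion)
  have J: "?J x \<in> vcarrier ?F" if "x \<in> V" for x
    using that by (auto simp: completion_carrier completion_embed_def C_const)
  show ?thesis
  proof
    fix P assume P: "P \<in> cauchy_seqs ?F"
    have "\<forall>n. \<exists>x\<in>V. vdist ?F (P n) (?J x) < 1 / Suc n"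
      using completion_embed_dense F.C_closed[OF P] by simp
    then obtain X where X: "\<And>n. X n \<in> V" and PX: "\<And>n. vdist ?F (P n) (?J (X n)) < 1 / Suc n"
      by metis
    have small: "\<exists>k. \<forall>n\<ge>k. vdist ?F (P n) (?J (X n)) < e" if "e > 0" for e
    proof -
      obtain k where k: "1 / Suc k < e" using \<open>e > 0\<close> nat_approx_posE by blast
      have "vdist ?F (P n) (?J (X n)) < e" if "n \<ge> k" for n
      proof -
        have "1 / real (Suc n) \<le> 1 / Suc k" using that by (simp add: frac_le)
        then show ?thesis using PX[of n] k by linarith
      qed
      then show ?thesis by blast
    qed
    have XC: "X \<in> C"
      unfolding cauchy_seqs_def
    proof (intro CollectI conjI allI impI X)
      fix e :: real assume "e > 0"
      then obtain k l where k: "\<forall>n\<ge>k. vdist ?F (P n) (?J (X n)) < e / 3"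
        and l: "\<forall>m\<ge>l. \<forall>n\<ge>l. vdist ?F (P m) (P n) < e / 3"
        using small[of "e/3"] F.C_D[OF P, of "e/3"] by auto
      have "vdist E (X m) (X n) < e" if "m \<ge> max k l" "n \<ge> max k l" for m n
      proof -
        have c: "P m \<in> vcarrier ?F" "P n \<in> vcarrier ?F" "?J (X m) \<in> vcarrier ?F"
          "?J (X n) \<in> vcarrier ?F"
          using F.C_closed[OF P] J X by auto
        have "vdist ?F (P m) (?J (X m)) < e / 3" "vdist ?F (P n) (?J (X n)) < e / 3"
          "vdist ?F (P m) (P n) < e / 3"
          using k l that by auto
        moreover have "vdist ?F (?J (X m)) (P m) = vdist ?F (P m) (?J (X m))"
          using c by (simp add: F.vdist_commute)
        moreover have "vdist ?F (?J (X m)) (?J (X n))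
            \<le> vdist ?F (?J (X m)) (P m) + vdist ?F (P m) (?J (X n))"
          "vdist ?F (P m) (?J (X n)) \<le> vdist ?F (P m) (P n) + vdist ?F (P n) (?J (X n))"
          using c by (simp_all add: F.vdist_triangle)
        ultimately show ?thesis using X by (simp add: completion_embed_vdist)
      qed
      then show "\<exists>k. \<forall>m\<ge>k. \<forall>n\<ge>k. vdist E (X m) (X n) < e" by blast
    qed
    have cX: "cls X \<in> vcarrier ?F" using XC by (simp add: completion_carrier)
    have "(\<lambda>n. vdist ?F (P n) (cls X)) \<longlonglongrightarrow> 0"
    proof (rule LIMSEQ_I)
      fix e :: real assume e: "e > 0"
      obtain k where k: "\<forall>n\<ge>k. vdist ?F (P n) (?J (X n)) < e / 3"
        using small[of "e/3"] e by auto
      obtain l where l: "\<forall>m\<ge>l. \<forall>n\<ge>l. vdist E (X m) (X n) < e / 3"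
        using C_D[OF XC, of "e/3"] e by auto
      have "vdist ?F (P n) (cls X) < e" if n: "n \<ge> max k l" for n
      proof -
        have c: "P n \<in> vcarrier ?F" "?J (X n) \<in> vcarrier ?F" using F.C_closed[OF P] J X by auto
        have "vdist ?F (cls X) (?J (X n)) \<le> e / 3"
          by (rule LIMSEQ_le_const2[OF completion_vdist_const[OF XC X]])
            (use l n in \<open>auto intro!: exI[of _ l] less_imp_le\<close>)
        moreover have "vdist ?F (P n) (?J (X n)) < e / 3" using k n by simp
        moreover have "vdist ?F (P n) (cls X)
            \<le> vdist ?F (P n) (?J (X n)) + vdist ?F (?J (X n)) (cls X)"
          "vdist ?F (?J (X n)) (cls X) = vdist ?F (cls X) (?J (X n))"
          using c cX by (simp_all add: F.vdist_triangle F.vdist_commute)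
        ultimately show ?thesis using e by simp
      qed
      then show "\<exists>no. \<forall>n\<ge>no. norm (vdist ?F (P n) (cls X) - 0) < e"
        using F.vdist_nonneg[OF F.C_closed[OF P] cX] by (intro exI[of _ "max k l"]) (auto simp: abs_of_nonneg)
    qed
    with cX show "\<exists>x\<in>vcarrier ?F. (\<lambda>n. vdist ?F (P n) x) \<longlonglongrightarrow> 0" by blast
  qed
qed

end

lemma banach_vs_A_space:
  assumes "\<And>n. n \<ge> 1 \<Longrightarrow> absolute_normalized_norm (N n)"
  shows "banach_vs (A_space N)"
  unfolding A_space_def
  by (intro normed_vs.banach_vs_completion normed_vs_c00_space assms)

lemma banach_vs_X_space: "\<lbrakk>0 < c; c < 1\<rbrakk> \<Longrightarrow> banach_vs (X_space c)"
  unfolding X_space_def by (intro banach_vs_A_space absolute_normalized_norm_Nc)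

lemma X_space_embed_norm:
  assumes "0 < c" "c < 1" "x \<in> c00"
  shows "vnorm (X_space c) (completion_embed (c00_space (Nc c)) x) = X_norm c x"
proof -
  interpret normed_vs "c00_space (Nc c)"
    using assms by (intro normed_vs_c00_space absolute_normalized_norm_Nc)
  show ?thesis
    using completion_embed_norm[of x] assms(3)
    by (simp add: X_space_def A_space_def X_norm_def c00_space_def)
qed


end

theory Submission
  imports Defs
begin

text \<open>
  The bounds on \<open>N\<^sub>n\<close> say that its \<open>2n\<close>-th power lies between \<open>(s\<^sup>2 + c\<^sup>2t\<^sup>2)\<^sup>n\<close> and
  \<open>(s\<^sup>2 + t\<^sup>2)\<^sup>n\<close>. The lower one only drops a nonnegative summand. The upper one says that
  \<open>d\<^sup>n - e\<^sup>n\<close>, with \<open>d = t\<^sup>2\<close> and \<open>e = c\<^sup>2t\<^sup>2\<close>, does not decrease when both \<open>d\<close> and \<open>e\<close> are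
  shifted by \<open>s\<^sup>2\<close> (\<open>power_diff_mono_shift\<close>). In both bounds \<open>s\<close> has coefficient 1, so they
  iterate: substituting the norm of the first coordinates for \<open>s\<close> adds one square at each step
  (\<open>M_norm_bounds\<close>).

  The rest depends only on \<open>c \<parallel>x\<parallel>\<^sub>2 \<le> \<parallel>x\<parallel> \<le> \<parallel>x\<parallel>\<^sub>2\<close> on finitely supported sequences. Because the
  sequence space is complete and truncations converge, sending a sequence to the class of its
  truncations is a linear bijection onto the completion with the same bounds
  (\<open>ell2_isomorphism_completion\<close>). Any linear bijection \<open>T\<close> from the sequence space with
  \<open>a \<parallel>x\<parallel>\<^sub>2 \<le> \<parallel>T x\<parallel> \<le> b \<parallel>x\<parallel>\<^sub>2\<close> shows that the Banach--Mazur distance is at most \<open>b / a\<close>.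
  By Riesz representation, inverting the adjoint of \<open>T\<close> gives a linear bijection from the sequence
  space onto the dual, with bounds \<open>1 / b\<close> and \<open>1 / a\<close> (\<open>ell2_isomorphism_dual\<close>). Their quotient is
  again \<open>b / a\<close>, which is the claim on the dual. Since this construction applies to the dual as well,
  the bidual is the image of \<open>T\<close> dualized twice, and that map is \<open>T\<close> followed by the canonical
  embedding. So the embedding is onto.
\<close>


section \<open>The space of square-summable sequences\<close>

abbreviation sq_summable :: "(nat \<Rightarrow> real) \<Rightarrow> bool" where
  "sq_summable x \<equiv> summable (\<lambda>j. (x j)\<^sup>2)"

lemma ell2_simps [simp]:
  "x \<in> vcarrier ell2 \<longleftrightarrow> sq_summable x"
  "vadd ell2 x y = (\<lambda>j. x j + y j)"
  "vscale ell2 a x = (\<lambda>j. a * x j)"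
  "vnorm ell2 = ell2_norm"
  by (simp_all add: ell2_def)

lemma ell2_norm_nonneg: "sq_summable x \<Longrightarrow> 0 \<le> ell2_norm x"
  by (simp add: ell2_norm_def suminf_nonneg)

lemma ell2_norm_sq: "sq_summable x \<Longrightarrow> (ell2_norm x)\<^sup>2 = (\<Sum>j. (x j)\<^sup>2)"
  by (simp add: ell2_norm_def suminf_nonneg)

lemma ell2_norm_zero [simp]: "ell2_norm (\<lambda>j. 0) = 0"
  by (simp add: ell2_norm_def)

lemma sq_summable_scale: "sq_summable x \<Longrightarrow> sq_summable (\<lambda>j. a * x j)"
  by (simp add: power_mult_distrib summable_mult)

lemma ell2_norm_scale: "sq_summable x \<Longrightarrow> ell2_norm (\<lambda>j. a * x j) = \<bar>a\<bar> * ell2_norm x"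
  by (simp add: ell2_norm_def power_mult_distrib suminf_mult real_sqrt_mult)

text \<open>
  The infinite-dimensional facts below are limits of the finite-dimensional ones for
  \<^const>\<open>L2_set\<close>; the next two lemmas pass from one to the other.
\<close>

lemma L2_set_le_ell2_norm: "sq_summable x \<Longrightarrow> L2_set x {..<n} \<le> ell2_norm x"
  by (simp add: L2_set_def ell2_norm_def sum_le_suminf)

lemma ell2_norm_leI:
  assumes "\<And>n. L2_set x {..<n} \<le> K"
  shows "sq_summable x" "ell2_norm x \<le> K"
proof -
  have "0 \<le> K" using assms[of 0] by simp
  have le: "(\<Sum>j<n. (x j)\<^sup>2) \<le> K\<^sup>2" for n
    using assms[of n] unfolding L2_set_def by (rule sqrt_le_D)
  then show *: "sq_summable x" by (intro summableI_nonneg_bounded[of _ "K\<^sup>2"]) auto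
  show "ell2_norm x \<le> K"
    unfolding ell2_norm_def using \<open>0 \<le> K\<close> suminf_le_const[OF * le] by (rule real_le_lsqrt)
qed

lemma ell2_triangle:
  assumes "sq_summable x" "sq_summable y"
  shows "sq_summable (\<lambda>j. x j + y j)" "ell2_norm (\<lambda>j. x j + y j) \<le> ell2_norm x + ell2_norm y"
proof -
  have "L2_set (\<lambda>j. x j + y j) {..<n} \<le> ell2_norm x + ell2_norm y" for n
    using L2_set_triangle_ineq[of x y "{..<n}"] L2_set_le_ell2_norm[OF assms(1), of n]
      L2_set_le_ell2_norm[OF assms(2), of n] by linarith
  then show "sq_summable (\<lambda>j. x j + y j)" "ell2_norm (\<lambda>j. x j + y j) \<le> ell2_norm x + ell2_norm y"
    by (rule ell2_norm_leI)+
qed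

lemma sq_summable_diff:
  assumes "sq_summable x" "sq_summable y"
  shows "sq_summable (\<lambda>j. x j - y j)"
  using ell2_triangle(1)[OF assms(1) sq_summable_scale[OF assms(2), of "-1"]] by simp

lemma ell2_norm_minus_commute: "ell2_norm (\<lambda>j. x j - y j) = ell2_norm (\<lambda>j. y j - x j)"
  by (simp add: ell2_norm_def power2_commute)

lemma ell2_diff_triangle:
  assumes "sq_summable x" "sq_summable y" "sq_summable z"
  shows "ell2_norm (\<lambda>j. x j - z j) \<le> ell2_norm (\<lambda>j. x j - y j) + ell2_norm (\<lambda>j. y j - z j)"
  using ell2_triangle(2)[OF sq_summable_diff[OF assms(1,2)] sq_summable_diff[OF assms(2,3)]] by simp

text \<open>
  A Cauchy sequence converges coordinatewise. Letting one index tend to infinity in the Cauchy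
  condition, on finitely many coordinates at a time, shows that the convergence is in norm.
\<close>

lemma ell2_complete:
  fixes X :: "nat \<Rightarrow> nat \<Rightarrow> real"
  assumes X: "\<And>n. sq_summable (X n)"
    and C: "\<And>e. e > 0 \<Longrightarrow> \<exists>k. \<forall>m\<ge>k. \<forall>n\<ge>k. ell2_norm (\<lambda>j. X m j - X n j) < e"
  obtains x where "sq_summable x" "(\<lambda>n. ell2_norm (\<lambda>j. X n j - x j)) \<longlonglongrightarrow> 0"
proof -
  have coord: "\<bar>z j\<bar> \<le> ell2_norm z" if "sq_summable z" for z j
    using sum_le_suminf[OF that, of "{j}"] by (simp add: ell2_norm_def real_le_rsqrt)
  have "\<exists>l. (\<lambda>n. X n j) \<longlonglongrightarrow> l" for j
  proof -
    have "Cauchy (\<lambda>n. X n j)"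
      unfolding Cauchy_def dist_real_def
      using C coord[OF sq_summable_diff[OF X X]] by (meson order_le_less_trans)
    then show ?thesis by (simp add: Cauchy_convergent_iff convergent_def)
  qed
  then obtain x where x: "\<And>j. (\<lambda>n. X n j) \<longlonglongrightarrow> x j" by metis
  have close: "\<exists>k. \<forall>n\<ge>k. sq_summable (\<lambda>j. X n j - x j) \<and> ell2_norm (\<lambda>j. X n j - x j) \<le> e"
    if e: "e > 0" for e
  proof -
    obtain k where k: "\<forall>m\<ge>k. \<forall>n\<ge>k. ell2_norm (\<lambda>j. X m j - X n j) < e" using C[OF e] by blast
    have "L2_set (\<lambda>j. X n j - x j) {..<i} \<le> e" if n: "n \<ge> k" for n i
    proof (rule LIMSEQ_le_const2)
      show "(\<lambda>m. L2_set (\<lambda>j. X n j - X m j) {..<i}) \<longlonglongrightarrow> L2_set (\<lambda>j. X n j - x j) {..<i}"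
        unfolding L2_set_def by (intro tendsto_intros x)
      have "L2_set (\<lambda>j. X n j - X m j) {..<i} \<le> e" if "m \<ge> k" for m
        using L2_set_le_ell2_norm[OF sq_summable_diff[OF X[of n] X[of m]], of i] k n that by fastforce
      then show "\<exists>N. \<forall>m\<ge>N. L2_set (\<lambda>j. X n j - X m j) {..<i} \<le> e" by blast
    qed
    then have "sq_summable (\<lambda>j. X n j - x j) \<and> ell2_norm (\<lambda>j. X n j - x j) \<le> e" if "n \<ge> k" for n
      using that by (intro conjI ell2_norm_leI)
    then show ?thesis by blast
  qed
  show ?thesis
  proof
    obtain k where "sq_summable (\<lambda>j. X k j - x j)" using close[of 1] by auto
    from sq_summable_diff[OF X[of k] this] show x2: "sq_summable x" by simp
    show "(\<lambda>n. ell2_norm (\<lambda>j. X n j - x j)) \<longlonglongrightarrow> 0"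
    proof (rule LIMSEQ_I)
      fix e :: real assume "e > 0"
      then obtain k where "\<forall>n\<ge>k. ell2_norm (\<lambda>j. X n j - x j) \<le> e / 2" using close[of "e / 2"] by auto
      moreover have "0 \<le> ell2_norm (\<lambda>j. X n j - x j)" for n
        by (intro ell2_norm_nonneg sq_summable_diff X x2)
      ultimately show "\<exists>no. \<forall>n\<ge>no. norm (ell2_norm (\<lambda>j. X n j - x j) - 0) < e"
        using \<open>e > 0\<close> by (intro exI[of _ k]) (fastforce simp: abs_of_nonneg)
    qed
  qed
qed


section \<open>Truncation and the inner product\<close>

definition truncation :: "nat \<Rightarrow> (nat \<Rightarrow> real) \<Rightarrow> nat \<Rightarrow> real" where
  "truncation n x = (\<lambda>j. if j < n then x j else 0)"

lemma truncation_sums: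
  "(\<lambda>j. (truncation n x j)\<^sup>2) sums (\<Sum>j<n. (x j)\<^sup>2)"
  using sums_finite[of "{..<n}" "\<lambda>j. (truncation n x j)\<^sup>2"] by (simp add: truncation_def)

lemma sq_summable_truncation: "sq_summable (truncation n x)"
  using truncation_sums by (rule sums_summable)

lemma ell2_norm_truncation: "ell2_norm (truncation n x) = L2_set x {..<n}"
  by (simp add: ell2_norm_def L2_set_def sums_unique[OF truncation_sums, symmetric])

lemma truncation_c00: "truncation n x \<in> c00"
proof -
  have "{j. truncation n x j \<noteq> 0} \<subseteq> {..<n}" by (auto simp: truncation_def)
  then show ?thesis unfolding c00_def using finite_subset by blast
qed

lemma ell2_norm_truncation_tendsto:
  "sq_summable x \<Longrightarrow> (\<lambda>n. ell2_norm (truncation n x)) \<longlonglongrightarrow> ell2_norm x"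
  unfolding ell2_norm_truncation unfolding L2_set_def ell2_norm_def
  by (intro tendsto_real_sqrt summable_LIMSEQ)

lemma truncation_tendsto:
  assumes x: "sq_summable x"
  shows "(\<lambda>n. ell2_norm (\<lambda>j. x j - truncation n x j)) \<longlonglongrightarrow> 0"
proof -
  have "(x j - truncation n x j)\<^sup>2 = (x j)\<^sup>2 - (truncation n x j)\<^sup>2" for n j
    by (simp add: truncation_def)
  then have "ell2_norm (\<lambda>j. x j - truncation n x j) = sqrt ((\<Sum>j. (x j)\<^sup>2) - (\<Sum>j<n. (x j)\<^sup>2))" for n
    unfolding ell2_norm_def
    using sums_diff[OF summable_sums[OF x] truncation_sums[of n x]] by (simp add: sums_iff)
  moreover have "(\<lambda>n. sqrt ((\<Sum>j. (x j)\<^sup>2) - (\<Sum>j<n. (x j)\<^sup>2))) \<longlonglongrightarrow>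
      sqrt ((\<Sum>j. (x j)\<^sup>2) - (\<Sum>j. (x j)\<^sup>2))"
    by (intro tendsto_intros summable_LIMSEQ x)
  ultimately show ?thesis by simp
qed

definition ell2_inner :: "(nat \<Rightarrow> real) \<Rightarrow> (nat \<Rightarrow> real) \<Rightarrow> real" where
  "ell2_inner x y = (\<Sum>j. x j * y j)"

lemma Cauchy_Schwarz_ell2:
  assumes "sq_summable x" "sq_summable y"
  shows "summable (\<lambda>j. x j * y j)" "\<bar>ell2_inner x y\<bar> \<le> ell2_norm x * ell2_norm y"
proof -
  have le: "(\<Sum>j<n. \<bar>x j * y j\<bar>) \<le> ell2_norm x * ell2_norm y" for n
  proof -
    have "(\<Sum>j<n. \<bar>x j * y j\<bar>) \<le> L2_set x {..<n} * L2_set y {..<n}"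
      using L2_set_mult_ineq[of x y "{..<n}"] by (simp add: abs_mult)
    also have "\<dots> \<le> ell2_norm x * ell2_norm y"
      by (intro mult_mono L2_set_le_ell2_norm ell2_norm_nonneg assms) auto
    finally show ?thesis .
  qed
  then have s: "summable (\<lambda>j. \<bar>x j * y j\<bar>)"
    by (intro summableI_nonneg_bounded) auto
  then show "summable (\<lambda>j. x j * y j)" by (rule summable_rabs_cancel)
  have "\<bar>ell2_inner x y\<bar> \<le> (\<Sum>j. \<bar>x j * y j\<bar>)"
    unfolding ell2_inner_def using s by (rule summable_rabs)
  also have "\<dots> \<le> ell2_norm x * ell2_norm y" using s le by (rule suminf_le_const)
  finally show "\<bar>ell2_inner x y\<bar> \<le> ell2_norm x * ell2_norm y" .
qed

lemma ell2_inner_commute: "ell2_inner x y = ell2_inner y x"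
  by (simp add: ell2_inner_def mult.commute)

lemma ell2_inner_self: "sq_summable x \<Longrightarrow> ell2_inner x x = (ell2_norm x)\<^sup>2"
  by (simp add: ell2_norm_sq) (simp add: ell2_inner_def power2_eq_square)

lemma ell2_inner_add_left:
  "\<lbrakk>sq_summable x; sq_summable x'; sq_summable y\<rbrakk>
    \<Longrightarrow> ell2_inner (\<lambda>j. x j + x' j) y = ell2_inner x y + ell2_inner x' y"
  by (simp add: ell2_inner_def distrib_right suminf_add Cauchy_Schwarz_ell2)

lemma ell2_inner_scale_left:
  "\<lbrakk>sq_summable x; sq_summable y\<rbrakk> \<Longrightarrow> ell2_inner (\<lambda>j. a * x j) y = a * ell2_inner x y"
  by (simp add: ell2_inner_def mult.assoc suminf_mult Cauchy_Schwarz_ell2)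

text \<open>
  The representing sequence of \<open>g\<close> must be \<open>y\<^sub>j = g e\<^sub>j\<close>. It is square-summable because
  evaluating \<open>g\<close> on truncations of \<open>y\<close> itself gives \<open>\<parallel>y\<restriction>n\<parallel>\<^sup>2 \<le> K \<parallel>y\<restriction>n\<parallel>\<close>.
\<close>

lemma Riesz_representation_ell2:
  assumes lin: "linear_op ell2 real_line g"
    and bd: "\<And>x. sq_summable x \<Longrightarrow> \<bar>g x\<bar> \<le> K * ell2_norm x" and K: "0 \<le> K"
  obtains y where "sq_summable y" "\<And>x. sq_summable x \<Longrightarrow> g x = ell2_inner x y"
proof -
  have add: "g (\<lambda>j. x j + y j) = g x + g y" if "sq_summable x" "sq_summable y" for x y
    using lin that by (simp add: linear_op_def real_line_def)
  have scale: "g (\<lambda>j. a * x j) = a * g x" if "sq_summable x" for x a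
    using lin that by (simp add: linear_op_def real_line_def)
  define y where "y j = g (\<lambda>i. if i = j then 1 else 0)" for j
  have unit: "sq_summable (\<lambda>i. if i = j then 1 else 0)" for j
    by (rule summable_finite[of "{j}"]) auto
  have fin: "g (truncation n x) = (\<Sum>j<n. x j * y j)" for n x
  proof (induction n)
    case 0
    show ?case using scale[of "\<lambda>j. 0" 0] by (simp add: truncation_def)
  next
    case (Suc n)
    have eq: "truncation (Suc n) x = (\<lambda>i. truncation n x i + x n * (if i = n then 1 else 0))"
      by (auto simp: truncation_def fun_eq_iff less_Suc_eq)
    have "g (truncation (Suc n) x) = g (truncation n x) + x n * y n"
      unfolding eq y_def by (simp only: add scale unit sq_summable_truncation sq_summable_scale)
    then show ?case using Suc by simp
  qed
  have "L2_set y {..<n} \<le> K" for n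
  proof -
    have "(L2_set y {..<n})\<^sup>2 = g (truncation n y)"
      by (simp add: L2_set_def sum_nonneg fin power2_eq_square flip: real_sqrt_mult)
    also have "\<dots> \<le> K * L2_set y {..<n}"
      using bd[OF sq_summable_truncation, of n y] by (simp add: ell2_norm_truncation)
    finally show ?thesis using L2_set_nonneg[of y "{..<n}"] K
      by (cases "L2_set y {..<n} = 0") (auto simp: power2_eq_square)
  qed
  then have y: "sq_summable y" by (rule ell2_norm_leI)
  have "g x = ell2_inner x y" if x: "sq_summable x" for x
  proof (rule LIMSEQ_unique)
    show "(\<lambda>n. g (truncation n x)) \<longlonglongrightarrow> ell2_inner x y"
      unfolding fin ell2_inner_def by (intro summable_LIMSEQ Cauchy_Schwarz_ell2 x y)
    have "\<bar>g x - g (truncation n x)\<bar> \<le> K * ell2_norm (\<lambda>j. x j - truncation n x j)" for n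
      using add[OF sq_summable_diff[OF x sq_summable_truncation[of n x]] sq_summable_truncation[of n x]]
        bd[OF sq_summable_diff[OF x sq_summable_truncation[of n x]]] by simp
    then have "(\<lambda>n. g x - g (truncation n x)) \<longlonglongrightarrow> 0"
      by (intro Lim_null_comparison[OF _ tendsto_mult_right_zero[OF truncation_tendsto[OF x], of K]])
        auto
    from tendsto_diff[OF tendsto_const this, of "g x"]
    show "(\<lambda>n. g (truncation n x)) \<longlonglongrightarrow> g x" by simp
  qed
  with y show ?thesis by (rule that)
qed


section \<open>Spaces isomorphic to the sequence space, and their duals\<close>

text \<open>
  Both constants are carried along because dualizing replaces \<open>(a, b)\<close> by \<open>(1 / b, 1 / a)\<close>. The
  map starts at the sequence space, so that its elements serve as coordinates for those of \<open>F\<close>.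
\<close>

definition ell2_isomorphism ::
    "real \<Rightarrow> real \<Rightarrow> 'a nspace \<Rightarrow> ((nat \<Rightarrow> real) \<Rightarrow> 'a) \<Rightarrow> bool" where
  "ell2_isomorphism a b F T \<longleftrightarrow> linear_op ell2 F T \<and> bij_betw T (vcarrier ell2) (vcarrier F) \<and>
     (\<forall>x\<in>vcarrier ell2. a * ell2_norm x \<le> vnorm F (T x) \<and> vnorm F (T x) \<le> b * ell2_norm x)"

locale ell2_iso =
  fixes a b :: real and F :: "'a nspace" and T
  assumes iso: "ell2_isomorphism a b F T" and a: "0 < a" and b: "0 < b"
begin

abbreviation T_inv where "T_inv \<equiv> inv_into (vcarrier ell2) T"

lemma bij: "bij_betw T (vcarrier ell2) (vcarrier F)"
  using iso by (simp add: ell2_isomorphism_def)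

lemma T_closed [simp]: "sq_summable x \<Longrightarrow> T x \<in> vcarrier F"
  using bij_betwE[OF bij] by simp

lemma T_inv_T [simp]: "sq_summable x \<Longrightarrow> T_inv (T x) = x"
  by (rule bij_betw_inv_into_left[OF bij]) simp

lemma T_T_inv [simp]: "z \<in> vcarrier F \<Longrightarrow> T (T_inv z) = z"
  by (rule bij_betw_inv_into_right[OF bij])

lemma T_inv_closed [simp]: "z \<in> vcarrier F \<Longrightarrow> sq_summable (T_inv z)"
  using bij_betwE[OF bij_betw_inv_into[OF bij]] by simp

lemma surj: "z \<in> vcarrier F \<Longrightarrow> \<exists>x. sq_summable x \<and> z = T x"
  by (rule exI[of _ "T_inv z"]) simp

lemma T_add: "\<lbrakk>sq_summable x; sq_summable y\<rbrakk> \<Longrightarrow> vadd F (T x) (T y) = T (\<lambda>j. x j + y j)"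
  using iso by (simp add: ell2_isomorphism_def linear_op_def)

lemma T_scale: "sq_summable x \<Longrightarrow> vscale F r (T x) = T (\<lambda>j. r * x j)"
  using iso by (simp add: ell2_isomorphism_def linear_op_def)

lemma T_lower: "sq_summable x \<Longrightarrow> a * ell2_norm x \<le> vnorm F (T x)"
  and T_upper: "sq_summable x \<Longrightarrow> vnorm F (T x) \<le> b * ell2_norm x"
  using iso by (simp_all add: ell2_isomorphism_def)

lemma T_inv_upper: "z \<in> vcarrier F \<Longrightarrow> ell2_norm (T_inv z) \<le> 1 / a * vnorm F z"
  using T_lower[of "T_inv z"] a by (simp add: field_simps)

lemma linear_T_inv: "linear_op F ell2 T_inv"
  unfolding linear_op_def
proof (intro conjI ballI allI)
  show "T_inv \<in> vcarrier F \<rightarrow> vcarrier ell2" by simp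
next
  fix z w assume "z \<in> vcarrier F" "w \<in> vcarrier F"
  then obtain x y where "sq_summable x" "z = T x" "sq_summable y" "w = T y" using surj by blast
  then show "T_inv (vadd F z w) = vadd ell2 (T_inv z) (T_inv w)" by (simp add: T_add ell2_triangle)
next
  fix r z assume "z \<in> vcarrier F"
  then obtain x where "sq_summable x" "z = T x" using surj by blast
  then show "T_inv (vscale F r z) = vscale ell2 r (T_inv z)" by (simp add: T_scale sq_summable_scale)
qed

lemma linear_T: "linear_op ell2 F T"
  using iso by (simp add: ell2_isomorphism_def)

lemma isomorphism_T_inv: "isomorphism F ell2 T_inv"
proof -
  have "inv_into (vcarrier F) T_inv x = T x" if "x \<in> vcarrier ell2" for x
    using inv_into_inv_into_eq[OF bij that] .
  then have "bounded_op ell2 F (inv_into (vcarrier F) T_inv)"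
    using linear_T T_upper ell2_triangle(1) sq_summable_scale
    by (auto simp: bounded_op_def linear_op_def intro!: exI[of _ b])
  moreover have "bounded_op F ell2 T_inv"
    using linear_T_inv T_inv_upper by (auto simp: bounded_op_def intro!: exI[of _ "1 / a"])
  ultimately show ?thesis
    using bij_betw_inv_into[OF bij] by (simp add: isomorphism_def)
qed

lemma isomorphic_ell2: "isomorphic F ell2"
  using isomorphism_T_inv by (auto simp: isomorphic_def)

lemma d_BM_ell2_le: "d_BM F ell2 \<le> ereal (b / a)"
proof -
  let ?W = "inv_into (vcarrier F) T_inv"
  have zero: "T (\<lambda>j. 0) \<in> vcarrier F" "vnorm F (T (\<lambda>j. 0)) = 0"
    using T_lower[of "\<lambda>j. 0"] T_upper[of "\<lambda>j. 0"] by simp_all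
  have W: "?W x = T x" if "sq_summable x" for x
    using inv_into_inv_into_eq[OF bij, of x] that by simp
  have Tinv: "ell2_norm (T_inv z) \<le> 1 / a" if "z \<in> vcarrier F" "vnorm F z \<le> 1" for z
    using T_inv_upper[OF that(1)] that(2) a by (simp add: field_simps)
  have T: "vnorm F (T x) \<le> b" if "sq_summable x" "ell2_norm x \<le> 1" for x
    using T_upper[OF that(1)] mult_left_mono[OF that(2), of b] b by linarith
  have "op_norm F ell2 T_inv \<le> 1 / a"
    unfolding op_norm_def
  proof (rule cSUP_least)
    have "T (\<lambda>j. 0) \<in> {z \<in> vcarrier F. vnorm F z \<le> 1}" using zero by simp
    then show "{z \<in> vcarrier F. vnorm F z \<le> 1} \<noteq> {}" by blast
  qed (use Tinv in auto)
  moreover have "op_norm ell2 F ?W \<le> b"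
    unfolding op_norm_def
  proof (rule cSUP_least)
    have "(\<lambda>j. 0) \<in> {x \<in> vcarrier ell2. vnorm ell2 x \<le> 1}" by simp
    then show "{x \<in> vcarrier ell2. vnorm ell2 x \<le> 1} \<noteq> {}" by blast
  qed (use W T in auto)
  moreover have "0 \<le> op_norm ell2 F ?W"
    unfolding op_norm_def
  proof (rule cSUP_upper2[where x = "\<lambda>j. 0"])
    show "bdd_above ((\<lambda>x. vnorm F (?W x)) ` {x \<in> vcarrier ell2. vnorm ell2 x \<le> 1})"
      by (rule bdd_aboveI[of _ b]) (use W T in auto)
  qed (use zero W in auto)
  ultimately have "op_norm F ell2 T_inv * op_norm ell2 F ?W \<le> 1 / a * b"
    using a by (intro mult_mono) auto
  then have "ereal (op_norm F ell2 T_inv * op_norm ell2 F ?W) \<le> ereal (b / a)" by simp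
  then show ?thesis
    unfolding d_BM_def by (intro INF_lower2[where i = T_inv]) (auto intro: isomorphism_T_inv)
qed

text \<open>
  The inverse of the adjoint of \<open>T\<close>, when the dual of the sequence space is identified with the
  sequence space by Riesz representation.
\<close>

definition dual_iso :: "(nat \<Rightarrow> real) \<Rightarrow> 'a \<Rightarrow> real" where
  "dual_iso y = (\<lambda>z\<in>vcarrier F. ell2_inner (T_inv z) y)"

lemma dual_iso_T: "\<lbrakk>sq_summable x; sq_summable y\<rbrakk> \<Longrightarrow> dual_iso y (T x) = ell2_inner x y"
  by (simp add: dual_iso_def)

lemma dual_iso_bound:
  assumes y: "sq_summable y" and z: "z \<in> vcarrier F"
  shows "\<bar>dual_iso y z\<bar> \<le> 1 / a * ell2_norm y * vnorm F z"
proof -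
  have "\<bar>dual_iso y z\<bar> \<le> ell2_norm (T_inv z) * ell2_norm y"
    using Cauchy_Schwarz_ell2(2)[OF T_inv_closed[OF z] y] z by (simp add: dual_iso_def)
  also have "\<dots> \<le> (1 / a * vnorm F z) * ell2_norm y"
    by (intro mult_right_mono T_inv_upper ell2_norm_nonneg y z)
  finally show ?thesis by (simp add: mult_ac)
qed

lemma dual_iso_closed:
  assumes y: "sq_summable y"
  shows "dual_iso y \<in> vcarrier (dual F)"
proof -
  have "linear_op F real_line (dual_iso y)"
    unfolding linear_op_def
  proof (intro conjI ballI allI)
    show "dual_iso y \<in> vcarrier F \<rightarrow> vcarrier real_line" by (simp add: real_line_def)
  next
    fix z w assume "z \<in> vcarrier F" "w \<in> vcarrier F"
    then obtain u v where "sq_summable u" "z = T u" "sq_summable v" "w = T v" using surj by blast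
    then show "dual_iso y (vadd F z w) = vadd real_line (dual_iso y z) (dual_iso y w)"
      using y by (simp add: T_add ell2_triangle dual_iso_T real_line_def ell2_inner_add_left)
  next
    fix r z assume "z \<in> vcarrier F"
    then obtain u where "sq_summable u" "z = T u" using surj by blast
    then show "dual_iso y (vscale F r z) = vscale real_line r (dual_iso y z)"
      using y by (simp add: T_scale sq_summable_scale dual_iso_T real_line_def ell2_inner_scale_left)
  qed
  moreover have "\<exists>K. \<forall>z\<in>vcarrier F. vnorm real_line (dual_iso y z) \<le> K * vnorm F z"
    using dual_iso_bound[OF y] by (intro exI[of _ "1 / a * ell2_norm y"]) (simp add: real_line_def)
  moreover have "dual_iso y \<in> extensional (vcarrier F)" by (simp add: dual_iso_def)
  ultimately show ?thesis by (simp add: dual_def bounded_op_def)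
qed

lemma dual_iso_surj:
  assumes f: "f \<in> vcarrier (dual F)"
  obtains y where "sq_summable y" "f = dual_iso y"
proof -
  have ext: "f \<in> extensional (vcarrier F)" and lin: "linear_op F real_line f"
    using f by (auto simp: dual_def bounded_op_def)
  obtain K where K: "\<forall>z\<in>vcarrier F. \<bar>f z\<bar> \<le> K * vnorm F z"
    using f by (auto simp: dual_def bounded_op_def real_line_def)
  have bd: "\<bar>f (T x)\<bar> \<le> \<bar>K\<bar> * b * ell2_norm x" if x: "sq_summable x" for x
  proof -
    have "0 \<le> vnorm F (T x)"
      using T_lower[OF x] mult_nonneg_nonneg[OF less_imp_le[OF a] ell2_norm_nonneg[OF x]] by linarith
    then have "K * vnorm F (T x) \<le> \<bar>K\<bar> * vnorm F (T x)" by (intro mult_right_mono) auto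
    also have "\<dots> \<le> \<bar>K\<bar> * (b * ell2_norm x)" by (intro mult_left_mono T_upper x) auto
    finally show ?thesis using bspec[OF K T_closed[OF x]] by (simp add: mult.assoc)
  qed
  have lin': "linear_op ell2 real_line (\<lambda>x. f (T x))"
    using lin by (auto simp: linear_op_def real_line_def simp flip: T_add T_scale)
  obtain y where y: "sq_summable y" "\<And>x. sq_summable x \<Longrightarrow> f (T x) = ell2_inner x y"
    by (rule Riesz_representation_ell2[OF lin' bd]) (use b in auto)
  have "f = dual_iso y"
  proof (rule extensionalityI[OF ext])
    show "dual_iso y \<in> extensional (vcarrier F)" by (simp add: dual_iso_def)
    fix z assume "z \<in> vcarrier F"
    then obtain x where "sq_summable x" "z = T x" using surj by blast
    then show "f z = dual_iso y z" using y by (simp add: dual_iso_T)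
  qed
  with y(1) show ?thesis by (rule that)
qed

lemma dual_iso_unit_ball:
  assumes y: "sq_summable y" and z: "z \<in> vcarrier F" "vnorm F z \<le> 1"
  shows "\<bar>dual_iso y z\<bar> \<le> 1 / a * ell2_norm y"
proof -
  have "1 / a * ell2_norm y * vnorm F z \<le> 1 / a * ell2_norm y * 1"
    using a z by (intro mult_left_mono mult_nonneg_nonneg ell2_norm_nonneg y) auto
  then show ?thesis using dual_iso_bound[OF y z(1)] by linarith
qed

lemma dual_iso_upper:
  assumes y: "sq_summable y"
  shows "vnorm (dual F) (dual_iso y) \<le> 1 / a * ell2_norm y"
proof -
  have "T (\<lambda>j. 0) \<in> {z \<in> vcarrier F. vnorm F z \<le> 1}"
    using T_upper[of "\<lambda>j. 0"] by simp
  then have "(SUP z\<in>{z \<in> vcarrier F. vnorm F z \<le> 1}. \<bar>dual_iso y z\<bar>) \<le> 1 / a * ell2_norm y"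
    using dual_iso_unit_ball[OF y] by (intro cSUP_least) blast+
  then show ?thesis by (simp add: dual_def op_norm_def real_line_def)
qed

text \<open>The supremum defining the norm of \<open>dual_iso y\<close> is tested on \<open>T y\<close>, divided by the
  bound \<open>b \<parallel>y\<parallel>\<^sub>2\<close> on its norm.\<close>

lemma dual_iso_lower:
  assumes y: "sq_summable y"
  shows "1 / b * ell2_norm y \<le> vnorm (dual F) (dual_iso y)"
proof -
  \<comment> \<open>If \<open>y = 0\<close> then \<open>r = 0\<close> by division by zero, and the test vector is \<open>0\<close>, as it should be.\<close>
  define r where "r = 1 / (b * ell2_norm y)"
  let ?x = "\<lambda>j. r * y j"
  have x: "sq_summable ?x" using y by (rule sq_summable_scale)
  have r: "0 \<le> r" using b ell2_norm_nonneg[OF y] by (simp add: r_def)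
  have "vnorm F (T ?x) \<le> b * (r * ell2_norm y)"
    using T_upper[OF x] r y by (simp add: ell2_norm_scale)
  also have "\<dots> \<le> 1" by (simp add: r_def)
  finally have x1: "vnorm F (T ?x) \<le> 1" .
  have val: "dual_iso y (T ?x) = 1 / b * ell2_norm y"
  proof -
    have "dual_iso y (T ?x) = r * (ell2_norm y)\<^sup>2"
      using dual_iso_T[OF x y] y by (simp only: ell2_inner_scale_left ell2_inner_self)
    then show ?thesis by (simp add: r_def power2_eq_square)
  qed
  have "\<bar>dual_iso y (T ?x)\<bar> \<le> (SUP z\<in>{z \<in> vcarrier F. vnorm F z \<le> 1}. \<bar>dual_iso y z\<bar>)"
  proof (rule cSUP_upper)
    show "bdd_above ((\<lambda>z. \<bar>dual_iso y z\<bar>) ` {z \<in> vcarrier F. vnorm F z \<le> 1})"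
      by (rule bdd_aboveI[of _ "1 / a * ell2_norm y"]) (use dual_iso_unit_ball[OF y] in blast)
  qed (use x x1 in simp)
  then have "1 / b * ell2_norm y \<le> (SUP z\<in>{z \<in> vcarrier F. vnorm F z \<le> 1}. \<bar>dual_iso y z\<bar>)"
    using val abs_ge_self[of "dual_iso y (T ?x)"] by linarith
  then show ?thesis by (simp add: dual_def op_norm_def real_line_def)
qed

text \<open>
  Injectivity is the uniqueness of the Riesz representative: applied to a difference \<open>y - y'\<close>,
  the pairing with \<open>T (y - y')\<close> recovers \<open>\<parallel>y - y'\<parallel>\<^sup>2\<close>.
\<close>

lemma ell2_isomorphism_dual: "ell2_isomorphism (1 / b) (1 / a) (dual F) dual_iso"
proof -
  have "linear_op ell2 (dual F) dual_iso"
    unfolding linear_op_def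
  proof (intro conjI ballI allI)
    show "dual_iso \<in> vcarrier ell2 \<rightarrow> vcarrier (dual F)" by (simp add: dual_iso_closed)
    show "dual_iso (vadd ell2 y y') = vadd (dual F) (dual_iso y) (dual_iso y')"
      if "y \<in> vcarrier ell2" "y' \<in> vcarrier ell2" for y y'
      using that
      by (auto simp: dual_iso_def dual_def fun_eq_iff restrict_def ell2_inner_add_left
          ell2_inner_commute[of "T_inv _"])
    show "dual_iso (vscale ell2 r y) = vscale (dual F) r (dual_iso y)"
      if "y \<in> vcarrier ell2" for r y
      using that
      by (auto simp: dual_iso_def dual_def fun_eq_iff restrict_def ell2_inner_scale_left
          ell2_inner_commute[of "T_inv _"])
  qed
  moreover have "bij_betw dual_iso (vcarrier ell2) (vcarrier (dual F))"
    unfolding bij_betw_def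
  proof
    show "inj_on dual_iso (vcarrier ell2)"
    proof (rule inj_onI)
      fix y y' assume "y \<in> vcarrier ell2" "y' \<in> vcarrier ell2" and eq: "dual_iso y = dual_iso y'"
      then have y: "sq_summable y" "sq_summable y'" by simp_all
      let ?d = "\<lambda>j. y j - y' j"
      have d: "sq_summable ?d" using y by (rule sq_summable_diff)
      have "ell2_inner y ?d = ell2_inner y' ?d"
        using dual_iso_T[OF d y(1)] dual_iso_T[OF d y(2)] eq by (simp add: ell2_inner_commute)
      then have "ell2_inner ?d ?d = 0"
        using ell2_inner_add_left[OF d y(2) d] by simp
      then have "(\<Sum>j. (?d j)\<^sup>2) = 0" using d by (simp add: ell2_inner_self ell2_norm_sq)
      then have "\<forall>j. (?d j)\<^sup>2 = 0" using suminf_eq_zero_iff[OF d] by simp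
      then show "y = y'" by (simp add: fun_eq_iff)
    qed
    show "dual_iso ` vcarrier ell2 = vcarrier (dual F)"
    proof
      show "dual_iso ` vcarrier ell2 \<subseteq> vcarrier (dual F)" using dual_iso_closed by auto
      show "vcarrier (dual F) \<subseteq> dual_iso ` vcarrier ell2"
      proof
        fix f assume "f \<in> vcarrier (dual F)"
        then obtain y where "sq_summable y" "f = dual_iso y" by (rule dual_iso_surj)
        then show "f \<in> dual_iso ` vcarrier ell2" by simp
      qed
    qed
  qed
  ultimately show ?thesis
    using dual_iso_upper dual_iso_lower by (simp add: ell2_isomorphism_def)
qed

lemma ell2_iso_dual: "ell2_iso (1 / b) (1 / a) (dual F) dual_iso"
  by unfold_locales (use ell2_isomorphism_dual a b in auto)

text \<open>
  The canonical embedding composed with \<open>T\<close> is the isomorphism obtained by dualizing \<open>T\<close> twice: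
  both send \<open>x\<close> to the functional \<open>dual_iso y \<mapsto> \<langle>x, y\<rangle>\<close>. So the embedding is onto.
\<close>

lemma reflexive: "reflexive F"
proof -
  interpret D: ell2_iso "1 / b" "1 / a" "dual F" dual_iso by (rule ell2_iso_dual)
  have "bidual_embed F (T x) = D.dual_iso x" if x: "sq_summable x" for x
  proof -
    have "f (T x) = ell2_inner (D.T_inv f) x" if f: "f \<in> vcarrier (dual F)" for f
    proof -
      obtain y where "sq_summable y" "f = dual_iso y" using dual_iso_surj[OF f] .
      then show ?thesis using x by (simp add: dual_iso_T ell2_inner_commute)
    qed
    then show ?thesis unfolding bidual_embed_def D.dual_iso_def by (intro restrict_ext)
  qed
  then have "bidual_embed F ` T ` vcarrier ell2 = D.dual_iso ` vcarrier ell2"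
    by (simp add: image_image)
  also have "\<dots> = vcarrier (dual (dual F))"
    using D.ell2_isomorphism_dual by (simp add: ell2_isomorphism_def bij_betw_def)
  also have "T ` vcarrier ell2 = vcarrier F"
    using bij by (simp add: bij_betw_def)
  finally show ?thesis by (simp add: reflexive_def)
qed

end


section \<open>Completing the finitely supported sequences\<close>

lemma c00_sq_summable: "x \<in> c00 \<Longrightarrow> sq_summable x"
  unfolding c00_def by (rule summable_finite) auto

text \<open>
  A square-summable sequence is sent to the class of the sequence of its truncations. Conversely,
  a Cauchy sequence for the given norm is Cauchy for the norm of square-summable sequences, and it
  is equivalent to the truncations of its limit there. The bounds survive because the norm of a
  class is the limit of the norms of the truncations.
\<close>

lemma ell2_isomorphism_completion:
  assumes nv: "normed_vs (c00_space N)" and a: "0 < a"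
    and lower: "\<And>x. x \<in> c00 \<Longrightarrow> a * ell2_norm x \<le> A_norm N x"
    and upper: "\<And>x. x \<in> c00 \<Longrightarrow> A_norm N x \<le> b * ell2_norm x"
  shows "ell2_isomorphism a b (A_space N)
    (\<lambda>x. null_rel (c00_space N) `` {\<lambda>n. truncation n x})"
proof -
  define E where "E = c00_space N"
  interpret normed_vs E unfolding E_def by (rule nv)
  let ?T = "\<lambda>x. cls (\<lambda>n. truncation n x)"
  have E: "vcarrier E = c00" "vadd E x y = (\<lambda>j. x j + y j)" "vscale E r x = (\<lambda>j. r * x j)"
    "vnorm E = A_norm N" for x y r
    by (simp_all add: E_def c00_space_def)
  have diff: "(\<lambda>j. x j - y j) \<in> c00" if "x \<in> c00" "y \<in> c00" for x y
    using add_closed[of x "vscale E (-1) y"] scale_closed[of y "-1"] that by (simp add: E)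
  have dist: "vdist E x y = A_norm N (\<lambda>j. x j - y j)" for x y by (simp add: vdist_def E)
  have upper_abs: "A_norm N x \<le> \<bar>b\<bar> * ell2_norm x" if "x \<in> c00" for x
    using upper[OF that] mult_right_mono[OF abs_ge_self ell2_norm_nonneg[OF c00_sq_summable[OF that]]]
    by (rule order_trans)
  have trunc: "(\<lambda>n. truncation n x) \<in> C" if x: "sq_summable x" for x
    unfolding cauchy_seqs_def
  proof (intro CollectI conjI allI impI)
    show "truncation i x \<in> V" for i by (simp add: E truncation_c00)
    fix e :: real assume e: "e > 0"
    have "(\<lambda>n. \<bar>b\<bar> * ell2_norm (\<lambda>j. x j - truncation n x j)) \<longlonglongrightarrow> 0"
      by (rule tendsto_mult_right_zero[OF truncation_tendsto[OF x]])
    from LIMSEQ_D[OF this, of "e / 2"] e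
    obtain k where k: "\<And>n. n \<ge> k \<Longrightarrow> \<bar>b\<bar> * ell2_norm (\<lambda>j. x j - truncation n x j) < e / 2"
      using ell2_norm_nonneg[OF sq_summable_diff[OF x sq_summable_truncation]]
      by (auto simp: abs_mult abs_of_nonneg)
    have "vdist E (truncation m x) (truncation n x) < e" if "m \<ge> k" "n \<ge> k" for m n
    proof -
      let ?d = "\<lambda>j. truncation m x j - truncation n x j"
      have d: "?d \<in> c00" by (intro diff truncation_c00)
      have "A_norm N ?d \<le> \<bar>b\<bar> * ell2_norm ?d"
        using d by (rule upper_abs)
      also have "\<dots> \<le> \<bar>b\<bar> * (ell2_norm (\<lambda>j. truncation m x j - x j) + ell2_norm (\<lambda>j. x j - truncation n x j))"
        by (intro mult_left_mono ell2_diff_triangle x sq_summable_truncation) auto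
      also have "\<dots> < e"
        using k[OF that(1)] k[OF that(2)] ell2_norm_minus_commute[of "truncation m x" x]
        by (simp add: distrib_left)
      finally show ?thesis by (simp add: dist)
    qed
    then show "\<exists>k. \<forall>m\<ge>k. \<forall>n\<ge>k. vdist E (truncation m x) (truncation n x) < e" by blast
  qed
  have bounds: "a * ell2_norm x \<le> vnorm (nspace_completion E) (?T x)"
    "vnorm (nspace_completion E) (?T x) \<le> b * ell2_norm x" if x: "sq_summable x" for x
  proof -
    note lim = completion_norm_lim[OF trunc[OF x]]
      tendsto_mult_left[OF ell2_norm_truncation_tendsto[OF x]]
    show "a * ell2_norm x \<le> vnorm (nspace_completion E) (?T x)"
      by (rule LIMSEQ_le[OF lim(2) lim(1)]) (simp add: E lower truncation_c00)
    show "vnorm (nspace_completion E) (?T x) \<le> b * ell2_norm x"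
      by (rule LIMSEQ_le[OF lim(1) lim(2)]) (simp add: E upper truncation_c00)
  qed
  have lin: "linear_op ell2 (nspace_completion E) ?T"
  proof -
    have "truncation n (\<lambda>j. x j + y j) = vadd E (truncation n x) (truncation n y)"
      "truncation n (\<lambda>j. r * x j) = vscale E r (truncation n x)" for n x y r
      by (auto simp: truncation_def E)
    then show ?thesis
      by (auto simp: linear_op_def completion_carrier completion_add completion_scale trunc)
  qed
  have inj: "inj_on ?T (vcarrier ell2)"
  proof (rule inj_onI)
    fix x y assume "x \<in> vcarrier ell2" "y \<in> vcarrier ell2" and eq: "?T x = ?T y"
    then have x: "sq_summable x" and y: "sq_summable y" by simp_all
    have d: "sq_summable (\<lambda>j. x j - y j)" using x y by (rule sq_summable_diff)
    have "truncation n (\<lambda>j. x j - y j) = (\<lambda>j. truncation n x j - truncation n y j)" for n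
      by (auto simp: truncation_def)
    then have "(\<lambda>n. A_norm N (truncation n (\<lambda>j. x j - y j))) \<longlonglongrightarrow> 0"
      using eq x y by (simp add: cls_eq_iff trunc dist)
    from LIMSEQ_le[OF tendsto_mult_left[OF ell2_norm_truncation_tendsto[OF d], of a] this]
    have "a * ell2_norm (\<lambda>j. x j - y j) \<le> 0" by (simp add: lower truncation_c00)
    then have "ell2_norm (\<lambda>j. x j - y j) = 0"
      using a ell2_norm_nonneg[OF d] by (simp add: mult_le_0_iff)
    then have "\<forall>j. (x j - y j)\<^sup>2 = 0"
      using suminf_eq_zero_iff[OF d] ell2_norm_sq[OF d] by simp
    then show "x = y" by (simp add: fun_eq_iff)
  qed
  have surj: "\<exists>x. sq_summable x \<and> cls Y = ?T x" if Y: "Y \<in> C" for Y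
  proof -
    have Yc: "Y n \<in> c00" for n using C_closed[OF Y] by (simp add: E)
    have "\<exists>k. \<forall>m\<ge>k. \<forall>n\<ge>k. ell2_norm (\<lambda>j. Y m j - Y n j) < e" if e: "e > 0" for e
    proof -
      obtain k where k: "\<forall>m\<ge>k. \<forall>n\<ge>k. vdist E (Y m) (Y n) < a * e" using C_D[OF Y, of "a * e"] a e by auto
      have "ell2_norm (\<lambda>j. Y m j - Y n j) < e" if "m \<ge> k" "n \<ge> k" for m n
      proof -
        have "a * ell2_norm (\<lambda>j. Y m j - Y n j) < a * e"
          using lower[OF diff[OF Yc[of m] Yc[of n]]] k that by (fastforce simp: dist)
        then show ?thesis using a by simp
      qed
      then show ?thesis by blast
    qed
    then obtain x where x: "sq_summable x" and lim: "(\<lambda>n. ell2_norm (\<lambda>j. Y n j - x j)) \<longlonglongrightarrow> 0"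
      using ell2_complete[of Y] c00_sq_summable[OF Yc] by blast
    have "(\<lambda>n. vdist E (Y n) (truncation n x)) \<longlonglongrightarrow> 0"
    proof (rule vdist_tendsto_0)
      show "Y n \<in> V" "truncation n x \<in> V" for n by (simp_all add: E Yc truncation_c00)
      show "vdist E (Y n) (truncation n x)
          \<le> \<bar>b\<bar> * (ell2_norm (\<lambda>j. Y n j - x j) + ell2_norm (\<lambda>j. x j - truncation n x j))" for n
      proof -
        let ?d = "\<lambda>j. Y n j - truncation n x j"
        have d: "?d \<in> c00" by (intro diff Yc truncation_c00)
        have "A_norm N ?d \<le> \<bar>b\<bar> * ell2_norm ?d"
          using d by (rule upper_abs)
        also have "\<dots> \<le> \<bar>b\<bar> * (ell2_norm (\<lambda>j. Y n j - x j) + ell2_norm (\<lambda>j. x j - truncation n x j))"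
          by (intro mult_left_mono ell2_diff_triangle x sq_summable_truncation c00_sq_summable Yc) auto
        finally show ?thesis by (simp add: dist)
      qed
      show "(\<lambda>n. \<bar>b\<bar> * (ell2_norm (\<lambda>j. Y n j - x j) + ell2_norm (\<lambda>j. x j - truncation n x j))) \<longlonglongrightarrow> 0"
        using tendsto_mult_right_zero[OF tendsto_add_zero[OF lim truncation_tendsto[OF x]]] .
    qed
    then have "cls Y = ?T x" by (simp add: cls_eq_iff[OF Y trunc[OF x]])
    with x show ?thesis by blast
  qed
  have "bij_betw ?T (vcarrier ell2) (vcarrier (nspace_completion E))"
    unfolding bij_betw_def completion_carrier
  proof (intro conjI inj)
    show "?T ` vcarrier ell2 = cls ` C"
    proof
      show "?T ` vcarrier ell2 \<subseteq> cls ` C" using trunc by auto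
      show "cls ` C \<subseteq> ?T ` vcarrier ell2" 
      proof
        fix P assume "P \<in> cls ` C"
        then obtain Y where "Y \<in> C" "P = cls Y" by (rule imageE)
        then obtain x where "sq_summable x" "P = ?T x" using surj by auto
        then show "P \<in> ?T ` vcarrier ell2" by (intro image_eqI[where x = x]) auto
      qed
    qed
  qed
  with lin bounds show ?thesis
    by (simp add: ell2_isomorphism_def A_space_def flip: E_def)
qed


section \<open>Comparison of the norms\<close>

text \<open>
  The right-hand side equals the left-hand side at \<open>u = 0\<close>, and its derivative in \<open>u\<close> is
  nonnegative. The induction splits \<open>d\<^sup>n\<^sup>+\<^sup>1 - e\<^sup>n\<^sup>+\<^sup>1\<close> as
  \<open>d (d\<^sup>n - e\<^sup>n) + (d - e) e\<^sup>n\<close> and compares the two terms separately.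
\<close>

lemma power_diff_mono_shift:
  fixes u d e :: real
  assumes "0 \<le> u" "0 \<le> e" "e \<le> d"
  shows "d ^ n - e ^ n \<le> (u + d) ^ n - (u + e) ^ n"
proof (induction n)
  case (Suc n)
  have "d * (d ^ n - e ^ n) \<le> (u + d) * ((u + d) ^ n - (u + e) ^ n)"
    using Suc assms by (intro mult_mono) (auto simp: power_mono)
  moreover have "(d - e) * e ^ n \<le> (d - e) * (u + e) ^ n"
    using assms by (intro mult_left_mono power_mono) auto
  ultimately show ?case by (simp add: algebra_simps)
qed simp

lemma Nc_lower:
  assumes c: "0 < c" "c < 1" and n: "n \<ge> 1"
  shows "sqrt (s\<^sup>2 + c\<^sup>2 * t\<^sup>2) \<le> Nc c n s t"
proof -
  let ?q = "sqrt (s\<^sup>2 + c\<^sup>2 * t\<^sup>2)"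
  have "?q ^ (2 * n) = (s\<^sup>2 + c\<^sup>2 * t\<^sup>2) ^ n" by (simp add: power_mult)
  moreover have "c ^ (2 * n) \<le> 1" using c by (simp add: power_le_one)
  ultimately have "?q ^ (2 * n) \<le> (1 - c ^ (2 * n)) * \<bar>t\<bar> ^ (2 * n) + (s\<^sup>2 + c\<^sup>2 * t\<^sup>2) ^ n" by simp
  then have "root (2 * n) (?q ^ (2 * n)) \<le> Nc c n s t" unfolding Nc_def using n by simp
  then show ?thesis using n by (simp add: real_root_power_cancel)
qed

text \<open>
  With \<open>u = s\<^sup>2\<close>, \<open>d = t\<^sup>2\<close> and \<open>e = c\<^sup>2t\<^sup>2\<close> the extra summand of \<^const>\<open>Nc\<close> is \<open>d\<^sup>n - e\<^sup>n\<close>.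
\<close>

lemma Nc_upper:
  assumes c: "0 < c" "c < 1" and n: "n \<ge> 1"
  shows "Nc c n s t \<le> sqrt (s\<^sup>2 + t\<^sup>2)"
proof -
  let ?q = "sqrt (s\<^sup>2 + t\<^sup>2)"
  have "c\<^sup>2 \<le> 1" using c by (simp add: power_le_one)
  then have "c\<^sup>2 * t\<^sup>2 \<le> t\<^sup>2" using mult_right_mono[of "c\<^sup>2" 1 "t\<^sup>2"] by simp
  then have "(t\<^sup>2) ^ n - (c\<^sup>2 * t\<^sup>2) ^ n \<le> (s\<^sup>2 + t\<^sup>2) ^ n - (s\<^sup>2 + c\<^sup>2 * t\<^sup>2) ^ n"
    by (intro power_diff_mono_shift) auto
  moreover have "(1 - c ^ (2 * n)) * \<bar>t\<bar> ^ (2 * n) = (t\<^sup>2) ^ n - (c\<^sup>2 * t\<^sup>2) ^ n"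
    by (simp add: power_mult power_mult_distrib left_diff_distrib)
  moreover have "?q ^ (2 * n) = (s\<^sup>2 + t\<^sup>2) ^ n" by (simp add: power_mult)
  ultimately have "Nc c n s t \<le> root (2 * n) (?q ^ (2 * n))" unfolding Nc_def using n by simp
  then show ?thesis using n by (simp add: real_root_power_cancel)
qed

text \<open>
  The squared norm of the first coordinates takes the place of \<open>s\<^sup>2\<close> in the bounds on \<^const>\<open>Nc\<close>.
  The coordinate \<open>x 0\<close> is never the second argument, so it keeps weight 1 in the lower bound.
\<close>

lemma M_norm_bounds:
  assumes c: "0 < c" "c < 1"
  shows "sqrt ((x 0)\<^sup>2 + c\<^sup>2 * (\<Sum>j<n. (x (Suc j))\<^sup>2)) \<le> M_norm (Nc c) n x \<and>
    M_norm (Nc c) n x \<le> sqrt (\<Sum>j<Suc n. (x j)\<^sup>2)"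
proof (induction n)
  case (Suc n)
  let ?M = "M_norm (Nc c) n x" and ?t = "\<bar>x (Suc n)\<bar>"
  let ?l = "(x 0)\<^sup>2 + c\<^sup>2 * (\<Sum>j<n. (x (Suc j))\<^sup>2)" and ?u = "\<Sum>j<Suc n. (x j)\<^sup>2"
  have l0: "0 \<le> ?l" and u0: "0 \<le> ?u" by (auto intro!: add_nonneg_nonneg mult_nonneg_nonneg sum_nonneg)
  have M0: "0 \<le> ?M" using Suc real_sqrt_ge_zero[OF l0] by linarith
  have l: "?l \<le> ?M\<^sup>2" using Suc by (blast intro: sqrt_le_D)
  have u: "?M\<^sup>2 \<le> ?u" using power_mono[of ?M "sqrt ?u" 2] Suc M0 u0 by simp
  have "sqrt ((x 0)\<^sup>2 + c\<^sup>2 * (\<Sum>j<Suc n. (x (Suc j))\<^sup>2)) \<le> sqrt (?M\<^sup>2 + c\<^sup>2 * ?t\<^sup>2)"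
    using l by (simp add: distrib_left)
  also have "\<dots> \<le> M_norm (Nc c) (Suc n) x" using Nc_lower[OF c, of "Suc n" ?M ?t] by simp
  finally have "sqrt ((x 0)\<^sup>2 + c\<^sup>2 * (\<Sum>j<Suc n. (x (Suc j))\<^sup>2)) \<le> M_norm (Nc c) (Suc n) x" .
  moreover have "M_norm (Nc c) (Suc n) x \<le> sqrt (?M\<^sup>2 + ?t\<^sup>2)" using Nc_upper[OF c, of "Suc n" ?M ?t] by simp
  moreover have "sqrt (?M\<^sup>2 + ?t\<^sup>2) \<le> sqrt (\<Sum>j<Suc (Suc n). (x j)\<^sup>2)" using u by simp
  ultimately show ?case by linarith
qed simp

lemma X_norm_bounds:
  assumes c: "0 < c" "c < 1" and x: "x \<in> c00"
  shows "sqrt (\<bar>x 0\<bar>\<^sup>2 + c\<^sup>2 * (\<Sum>j. \<bar>x (Suc j)\<bar>\<^sup>2)) \<le> X_norm c x"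
    and "X_norm c x \<le> ell2_norm x"
    and "c * ell2_norm x \<le> X_norm c x"
proof -
  have N: "\<And>n. n \<ge> 1 \<Longrightarrow> absolute_normalized_norm (Nc c n)"
    using c by (rule absolute_normalized_norm_Nc)
  obtain n where "{j. x j \<noteq> 0} \<subseteq> {..n}"
    using x unfolding c00_def finite_nat_iff_bounded_le by blast
  then have n: "\<forall>j>n. x j = 0" using not_le by blast
  have X: "X_norm c x = M_norm (Nc c) n x"
    unfolding X_norm_def using N n by (rule A_norm_eq_M)
  have tail: "(\<Sum>j. (x (Suc j))\<^sup>2) = (\<Sum>j<n. (x (Suc j))\<^sup>2)"
    by (rule suminf_finite) (use n in auto)
  have all: "(\<Sum>j. (x j)\<^sup>2) = (\<Sum>j<Suc n. (x j)\<^sup>2)"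
    by (rule suminf_finite) (use n in auto)
  show lower: "sqrt (\<bar>x 0\<bar>\<^sup>2 + c\<^sup>2 * (\<Sum>j. \<bar>x (Suc j)\<bar>\<^sup>2)) \<le> X_norm c x"
    using M_norm_bounds[OF c, of x n] by (simp add: X tail)
  show "X_norm c x \<le> ell2_norm x"
    using M_norm_bounds[OF c, of x n] by (simp add: X all ell2_norm_def)
  have "c * ell2_norm x = sqrt (c\<^sup>2 * ((x 0)\<^sup>2 + (\<Sum>j. (x (Suc j))\<^sup>2)))"
    using c unfolding ell2_norm_def all tail sum.lessThan_Suc_shift by (simp add: real_sqrt_mult)
  also have "\<dots> \<le> sqrt (\<bar>x 0\<bar>\<^sup>2 + c\<^sup>2 * (\<Sum>j. \<bar>x (Suc j)\<bar>\<^sup>2))"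
    using c mult_right_mono[of "c\<^sup>2" 1 "(x 0)\<^sup>2"] by (simp add: distrib_left power_le_one)
  finally show "c * ell2_norm x \<le> X_norm c x" using lower by linarith
qed

theorem lemma3p1:
  fixes c :: real
  assumes "0 < c" and "c < 1"
  shows "(\<forall>n\<ge>1. \<forall>s t. sqrt (s\<^sup>2 + c\<^sup>2 * t\<^sup>2) \<le> Nc c n s t \<and> Nc c n s t \<le> sqrt (s\<^sup>2 + t\<^sup>2)) \<and>
    (\<forall>x\<in>c00. sqrt (\<bar>x 0\<bar>\<^sup>2 + c\<^sup>2 * (\<Sum>j. \<bar>x (Suc j)\<bar>\<^sup>2)) \<le> X_norm c x \<and> X_norm c x \<le> ell2_norm x) \<and>
    (\<forall>x\<in>c00. c * ell2_norm x \<le> X_norm c x \<and> X_norm c x \<le> ell2_norm x) \<and>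
    isomorphic (X_space c) ell2 \<and>
    reflexive (X_space c) \<and>
    d_BM (X_space c) ell2 \<le> ereal (1 / c) \<and>
    d_BM (dual (X_space c)) ell2 \<le> ereal (1 / c)"
proof -
  have "normed_vs (c00_space (Nc c))"
    by (intro normed_vs_c00_space absolute_normalized_norm_Nc assms)
  then have "ell2_isomorphism c 1 (X_space c)
      (\<lambda>x. null_rel (c00_space (Nc c)) `` {\<lambda>n. truncation n x})"
    unfolding X_space_def
    by (rule ell2_isomorphism_completion)
      (use assms X_norm_bounds[OF assms] in \<open>auto simp: X_norm_def\<close>)
  then interpret X: ell2_iso c 1 "X_space c"
      "\<lambda>x. null_rel (c00_space (Nc c)) `` {\<lambda>n. truncation n x}"
    using assms by unfold_locales auto
  interpret D: ell2_iso "1 / 1" "1 / c" "dual (X_space c)" X.dual_iso by (rule X.ell2_iso_dual)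
  have "d_BM (dual (X_space c)) ell2 \<le> ereal (1 / c)" using D.d_BM_ell2_le by simp
  then show ?thesis
    by (intro conjI allI impI ballI Nc_lower Nc_upper X_norm_bounds
        X.isomorphic_ell2 X.reflexive X.d_BM_ell2_le assms)
qed

end
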